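(* Let $R$ be a 2-Henselian valuation ring and let $M$ and $N$ be $R$-lattices. Let $M=\bigoplus_{k=1}^{t}M_{k}$ be a Jordan decomposition of $M$ with $v(M_{1})<\cdots<v(M_{t})$, and assume that $M$ and $N$ are isomorphic when reduced modulo $I=I_{v(M_{t})+2v(2)}$ (that is, there is an isomorphism of $R/I$-modules $M/IM\to N/IN$ preserving the induced $R/I$-valued bilinear forms). Then $M\cong N$ as $R$-lattices.
   Context: A valuation ring $R$ is an integral domain with fraction field $\mathbb{K}$, together with a totally ordered abelian group $\Gamma$ (additive, arbitrary rank) and a surjective homomorphism $v:\mathbb{K}^{*}\to\Gamma$ satisfying $v(x+y)\geq\min\{v(x),v(y)\}$, extended by $v(0)=\infty$, such that $R=\{x\in\mathbb{K}: v(x)\geq0\}$. For $\gamma\in\Gamma$ put $I_{\gamma}=\{x\in\mathbb{K}: v(x)>\gamma\}$; $I_{0}$ is the maximal ideal of $R$. $R$ is 2-Henselian if $2\neq0$ in $R$ and for every monic $f\in R[x]$ of degree 2 and every $a\in R$ with $v(f(a))>0$ and $v(f'(a))=0$ there is a root $b\in R$ of $f$ with $b-a\in I_{0}$. An $R$-lattice is a free $R$-module $M$ of finite rank with a symmetric bilinear form $(\cdot,\cdot):M\times M\to R$ which is non-degenerate, i.e. the induced map $M\to \mathrm{Hom}_{R}(M,R)$ is injective; it is unimodular if this map is bijective. Isomorphisms of lattices are $R$-module isomorphisms preserving the bilinear forms. $L(a)$ denotes $L$ with the bilinear form multiplied by $0\neq a\in R$. The valuation of a lattice $M$ is $v(M)=\min\{v((x,y)):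 x,y\in M\}$. A lattice is uni-valued if it is $L(\sigma)$ with $L$ unimodular and $0\neq\sigma\in R$ (then its valuation is $v(\sigma)$). A Jordan decomposition of $M$ is an orthogonal direct sum decomposition $M=\bigoplus_{k=1}^{t}M_{k}$ into uni-valued lattices with pairwise distinct valuations. *)

theory Defs
  imports "HOL-Computational_Algebra.Polynomial" "HOL-Algebra.QuotRing" "HOL-Algebra.Module"
    "HOL-Algebra.Generated_Groups"
begin

section \<open>Valuation rings\<close>

text \<open>
  The value at \<open>0\<close> is conceptually \<open>\<infinity>\<close>.  Since \<open>v\<close> takes its values in the ordered group itself,
  \<open>v 0\<close> is left unspecified and the case of \<open>0\<close> is treated separately wherever \<open>v\<close> is used.
\<close>

locale valuation =
  fixes v :: "'k::field \<Rightarrow> 'g::linordered_ab_group_add"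
  assumes v_mult: "x \<noteq> 0 \<Longrightarrow> y \<noteq> 0 \<Longrightarrow> v (x * y) = v x + v y"
    and v_add: "x \<noteq> 0 \<Longrightarrow> y \<noteq> 0 \<Longrightarrow> x + y \<noteq> 0 \<Longrightarrow> min (v x) (v y) \<le> v (x + y)"
    and v_surj: "v ` (UNIV - {0}) = UNIV"

text \<open>
  The valuation ring is a subring of the field \<open>'k\<close>.  That \<open>'k\<close> is its fraction field needs no
  assumption: for \<open>x \<noteq> 0\<close> one of \<open>x\<close>, \<open>inverse x\<close> has nonnegative valuation.
\<close>

definition valring :: "('k::field \<Rightarrow> 'g::linordered_ab_group_add) \<Rightarrow> 'k ring" where
  "valring v = \<lparr>carrier = {x. x = 0 \<or> 0 \<le> v x}, mult = (*), one = 1, zero = 0, add = (+)\<rparr>"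

definition val_ideal :: "('k::field \<Rightarrow> 'g::linordered_ab_group_add) \<Rightarrow> 'g \<Rightarrow> 'k set" where
  "val_ideal v \<gamma> = {x. x = 0 \<or> \<gamma> < v x}"

locale two_henselian = valuation v for v :: "'k::field \<Rightarrow> 'g::linordered_ab_group_add" +
  assumes two_nonzero: "(2::'k) \<noteq> 0"
    and hensel2: "\<And>f a. \<lbrakk>\<forall>i. coeff f i \<in> carrier (valring v); degree f = 2; lead_coeff f = 1;
         a \<in> carrier (valring v);
         poly f a \<in> val_ideal v 0;
         poly (pderiv f) a \<noteq> 0; v (poly (pderiv f) a) = 0\<rbrakk>
       \<Longrightarrow> \<exists>b \<in> carrier (valring v). poly f b = 0 \<and> b - a \<in> val_ideal v 0"

section \<open>Lattices\<close>

definition free_finite_rank :: "('a, 'c) ring_scheme \<Rightarrow> ('a, 'm, 'd) module_scheme \<Rightarrow> bool" where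
  "free_finite_rank R M \<longleftrightarrow>
     (\<exists>B. finite B \<and> B \<subseteq> carrier M \<and>
        (\<forall>x \<in> carrier M. \<exists>!c. c \<in> B \<rightarrow>\<^sub>E carrier R \<and>
           x = (\<Oplus>\<^bsub>M\<^esub> b \<in> B. c b \<odot>\<^bsub>M\<^esub> b)))"

text \<open>Linearity in the second argument follows from symmetry.\<close>

definition symmetric_bilinear ::
    "('a, 'c) ring_scheme \<Rightarrow> ('a, 'm, 'd) module_scheme \<Rightarrow> ('m \<Rightarrow> 'm \<Rightarrow> 'a) \<Rightarrow> bool" where
  "symmetric_bilinear R M F \<longleftrightarrow>
     (\<forall>x \<in> carrier M. \<forall>y \<in> carrier M. F x y \<in> carrier R \<and> F x y = F y x) \<and>
     (\<forall>x \<in> carrier M. \<forall>x' \<in> carrier M. \<forall>y \<in> carrier M.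
        F (x \<oplus>\<^bsub>M\<^esub> x') y = F x y \<oplus>\<^bsub>R\<^esub> F x' y) \<and>
     (\<forall>a \<in> carrier R. \<forall>x \<in> carrier M. \<forall>y \<in> carrier M.
        F (a \<odot>\<^bsub>M\<^esub> x) y = a \<otimes>\<^bsub>R\<^esub> F x y)"

text \<open>
  The dual module \<open>Hom\<^sub>R(M, R)\<close>.  Functionals are taken to be extensional (\<open>undefined\<close> outside
  \<open>carrier M\<close>), so that equality of functionals is equality on \<open>carrier M\<close>.
\<close>

definition dual_module :: "('a, 'c) ring_scheme \<Rightarrow> ('a, 'm, 'd) module_scheme \<Rightarrow> ('m \<Rightarrow> 'a) set" where
  "dual_module R M = {f \<in> extensional (carrier M) \<inter> hom (add_monoid M) (add_monoid R).
     \<forall>a \<in> carrier R. \<forall>x \<in> carrier M. f (a \<odot>\<^bsub>M\<^esub> x) = a \<otimes>\<^bsub>R\<^esub> f x}"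

definition form_to_dual ::
    "('a, 'm, 'd) module_scheme \<Rightarrow> ('m \<Rightarrow> 'm \<Rightarrow> 'a) \<Rightarrow> 'm \<Rightarrow> ('m \<Rightarrow> 'a)" where
  "form_to_dual M F x = (\<lambda>y \<in> carrier M. F x y)"

definition is_lattice ::
    "('a, 'c) ring_scheme \<Rightarrow> ('a, 'm, 'd) module_scheme \<Rightarrow> ('m \<Rightarrow> 'm \<Rightarrow> 'a) \<Rightarrow> bool" where
  "is_lattice R M F \<longleftrightarrow>
     Module.module R M \<and> free_finite_rank R M \<and> symmetric_bilinear R M F \<and>
     inj_on (form_to_dual M F) (carrier M)"

definition unimodular ::
    "('a, 'c) ring_scheme \<Rightarrow> ('a, 'm, 'd) module_scheme \<Rightarrow> ('m \<Rightarrow> 'm \<Rightarrow> 'a) \<Rightarrow> bool" where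
  "unimodular R M F \<longleftrightarrow>
     is_lattice R M F \<and> bij_betw (form_to_dual M F) (carrier M) (dual_module R M)"

text \<open>
  The predicate makes sense for any modules with scalar-valued forms; it is used both for lattices
  and for their reductions modulo an ideal.
\<close>

definition form_isomorphic ::
    "('a, 'c) ring_scheme \<Rightarrow> ('a, 'm, 'd) module_scheme \<Rightarrow> ('m \<Rightarrow> 'm \<Rightarrow> 'a) \<Rightarrow>
     ('a, 'n, 'e) module_scheme \<Rightarrow> ('n \<Rightarrow> 'n \<Rightarrow> 'a) \<Rightarrow> bool" where
  "form_isomorphic R M F N G \<longleftrightarrow>
     (\<exists>\<phi> \<in> iso (add_monoid M) (add_monoid N).
        (\<forall>a \<in> carrier R. \<forall>x \<in> carrier M. \<phi> (a \<odot>\<^bsub>M\<^esub> x) = a \<odot>\<^bsub>N\<^esub> \<phi> x) \<and>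
        (\<forall>x \<in> carrier M. \<forall>y \<in> carrier M. G (\<phi> x) (\<phi> y) = F x y))"

section \<open>Jordan decompositions\<close>

text \<open>
  Pairs with \<open>F x y = 0\<close> have value \<open>\<infinity>\<close> and do not affect the minimum unless all values are \<open>0\<close>.
  For the zero lattice the result is meaningless.
\<close>

definition lattice_val ::
    "('k::field \<Rightarrow> 'g::linordered_ab_group_add) \<Rightarrow> ('k, 'm, 'd) module_scheme \<Rightarrow>
     ('m \<Rightarrow> 'm \<Rightarrow> 'k) \<Rightarrow> 'g" where
  "lattice_val v M F =
     (LEAST \<gamma>. \<exists>x \<in> carrier M. \<exists>y \<in> carrier M. F x y \<noteq> 0 \<and> \<gamma> = v (F x y))"

definition uni_valued ::
    "('a, 'c) ring_scheme \<Rightarrow> ('a, 'm, 'd) module_scheme \<Rightarrow> ('m \<Rightarrow> 'm \<Rightarrow> 'a) \<Rightarrow> bool" where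
  "uni_valued R M F \<longleftrightarrow>
     (\<exists>\<sigma> \<in> carrier R. \<exists>G. \<sigma> \<noteq> \<zero>\<^bsub>R\<^esub> \<and> unimodular R M G \<and>
        (\<forall>x \<in> carrier M. \<forall>y \<in> carrier M. F x y = \<sigma> \<otimes>\<^bsub>R\<^esub> G x y))"

text \<open>
  Internal orthogonal direct sums of submodules \<open>K 1, \<dots>, K t\<close>, each with the restricted form.
  The components are required to be nonzero: the zero module has valuation \<open>\<infinity>\<close>, which is not
  an element of the value group.
\<close>

definition jordan_decomposition ::
    "('k::field \<Rightarrow> 'g::linordered_ab_group_add) \<Rightarrow> ('k, 'm, 'd) module_scheme \<Rightarrow>
     ('m \<Rightarrow> 'm \<Rightarrow> 'k) \<Rightarrow> nat \<Rightarrow> (nat \<Rightarrow> 'm set) \<Rightarrow> bool" where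
  "jordan_decomposition v M F t K \<longleftrightarrow>
     (\<forall>k \<in> {1..t}. submodule (K k) (valring v) M \<and> K k \<noteq> {\<zero>\<^bsub>M\<^esub>} \<and>
        uni_valued (valring v) (M\<lparr>carrier := K k\<rparr>) F) \<and>
     (\<forall>x \<in> carrier M. \<exists>!f. f \<in> (\<Pi>\<^sub>E k \<in> {1..t}. K k) \<and> x = (\<Oplus>\<^bsub>M\<^esub> k \<in> {1..t}. f k)) \<and>
     (\<forall>i \<in> {1..t}. \<forall>j \<in> {1..t}. i \<noteq> j \<longrightarrow> (\<forall>x \<in> K i. \<forall>y \<in> K j. F x y = 0)) \<and>
     inj_on (\<lambda>k. lattice_val v (M\<lparr>carrier := K k\<rparr>) F) {1..t}"

section \<open>Reduction modulo an ideal\<close>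

text \<open>The additive subgroup generated by the products is already closed under scalars.\<close>

definition ideal_smult :: "'a set \<Rightarrow> ('a, 'm, 'd) module_scheme \<Rightarrow> 'm set" where
  "ideal_smult I M = generate (add_monoid M) {a \<odot>\<^bsub>M\<^esub> x | a x. a \<in> I \<and> x \<in> carrier M}"

text \<open>
  The module \<open>M / IM\<close> over \<open>R Quot I\<close>.  The fields \<open>mult\<close> and \<open>one\<close> play no role in modules.
  As in \<^const>\<open>rcoset_mult\<close>, the unions below run over equal cosets.
\<close>

definition quot_module :: "'a set \<Rightarrow> ('a, 'm, 'd) module_scheme \<Rightarrow> ('a set, 'm set) module" where
  "quot_module I M =
     \<lparr>carrier = a_rcosets\<^bsub>M\<^esub> (ideal_smult I M), mult = undefined, one = undefined,
      zero = ideal_smult I M, add = set_add M,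
      smult = (\<lambda>A X. \<Union>a \<in> A. \<Union>x \<in> X. ideal_smult I M +>\<^bsub>M\<^esub> (a \<odot>\<^bsub>M\<^esub> x))\<rparr>"

definition quot_form ::
    "('a, 'c) ring_scheme \<Rightarrow> 'a set \<Rightarrow> ('m \<Rightarrow> 'm \<Rightarrow> 'a) \<Rightarrow> 'm set \<Rightarrow> 'm set \<Rightarrow> 'a set" where
  "quot_form R I F X Y = (\<Union>x \<in> X. \<Union>y \<in> Y. I +>\<^bsub>R\<^esub> F x y)"

end

theory Submission
  imports Defs "Jordan_Normal_Form.Matrix"
begin

text \<open>
  Fix a basis of \<open>M\<close> and lift the images of its elements under the isomorphism modulo \<open>I\<close> to \<open>N\<close>.  Let \<open>A\<close>
  and \<open>B\<close> be the Gram matrices of the basis and of the lifts, and let \<open>s\<close> be the scaling factor of the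
  last Jordan component.  All entries of \<open>B - A\<close> have value greater than \<open>v s + 2 v 2\<close>.  The Jordan
  decomposition shows that \<open>s A\<^sup>-\<^sup>1\<close> is integral: every functional on a component \<open>M\<^sub>k = L(\<sigma>\<^sub>k)\<close> is
  \<open>\<sigma>\<^sub>k\<^sup>-\<^sup>1 (x, \<cdot>)\<close> for some \<open>x\<close>, and every \<open>\<sigma>\<^sub>k\<close> divides \<open>s\<close> (\<open>jordan_functionals\<close>).

  These two properties imply \<open>A = X\<^sup>T B X\<close> for some \<open>X \<in> GL\<^sub>n(R)\<close> (\<open>close_forms_congruent\<close>).  Only
  quadratic equations can be solved over \<open>R\<close>, so \<open>X\<close> is built by elimination.  Choose a nonzero entry of
  \<open>A\<close> of minimal value.  If it can be chosen on the diagonal, it is a pivot block of size \<open>1\<close>; otherwise it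
  is the off-diagonal entry of a pivot block of size \<open>2\<close> whose diagonal entries have larger value.
  Minimality makes the elimination of the remaining entries in the rows of the pivot integral, for \<open>A\<close>
  and for \<open>B\<close> at the same time, and the Schur complements again satisfy the hypotheses
  (\<open>pivot_step\<close>).  What remains is the comparison of the two pivot blocks, \<open>rank_one_solution\<close> and
  \<open>plane_solution_normalised\<close>.  Both reduce to equations \<open>2 t + c t\<^sup>2 + d = 0\<close> with \<open>c \<in> R\<close> and
  \<open>v d > 2 v 2\<close>.  The substitution \<open>t = 2 u\<close> divides such an equation by \<open>4\<close>, and \<open>w = c u\<close> turns it into
  the monic equation \<open>w\<^sup>2 + w + c d / 4 = 0\<close>, which has \<open>0\<close> as a simple root modulo the maximal ideal.
  This is where the \<open>2\<close>-Henselian property and the summand \<open>2 v 2\<close> in the bound come from.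

  Finally, \<open>X\<close> corrects the lifts so that their Gram matrix becomes \<open>A\<close>.  Sending the basis of \<open>M\<close> to the
  corrected lifts preserves the forms.  This map is injective because the form on \<open>M\<close> is
  non-degenerate, and surjective by Nakayama's lemma (\<open>nakayama\<close>), because the lifts generate \<open>N\<close> modulo
  \<open>IN\<close> and \<open>I\<close> lies in the maximal ideal.
\<close>

section \<open>Quadratic equations over a 2-Henselian valuation ring\<close>

context valuation
begin

text \<open>
  The value of \<open>0\<close> is \<open>\<infinity>\<close>, which is not in the range of \<open>v\<close>; the disjunction in the next two definitions
  encodes this.
\<close>

definition vge :: "'g \<Rightarrow> 'k \<Rightarrow> bool" where "vge g x \<longleftrightarrow> x = 0 \<or> g \<le> v x"

definition vgt :: "'g \<Rightarrow> 'k \<Rightarrow> bool" where "vgt g x \<longleftrightarrow> x = 0 \<or> g < v x"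

lemma val_one [simp]: "v 1 = 0"
  using v_mult[of 1 1] by simp

lemma val_minus [simp]: "v (- x) = v x"
proof (cases "x = 0")
  case False
  have "v (-1) + v (-1) = 0" using v_mult[of "-1" "-1"] by simp
  then have "v (-1) = 0" by simp
  then show ?thesis using v_mult[of "-1" x] False by simp
qed simp

lemma val_inverse: "x \<noteq> 0 \<Longrightarrow> v (inverse x) = - v x"
  using v_mult[of x "inverse x"] by (simp add: eq_neg_iff_add_eq_0 add.commute)

lemma val_divide: "x \<noteq> 0 \<Longrightarrow> y \<noteq> 0 \<Longrightarrow> v (x / y) = v x - v y"
  using v_mult[of x "inverse y"] val_inverse[of y] by (simp add: divide_inverse)

lemma vge_zero [simp]: "vge g 0" and vgt_zero [simp]: "vgt g 0"
  by (auto simp: vge_def vgt_def)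

lemma vgt_imp_vge: "vgt g x \<Longrightarrow> vge g x"
  by (auto simp: vge_def vgt_def)

lemma vge_mono: "vge g x \<Longrightarrow> h \<le> g \<Longrightarrow> vge h x"
  by (auto simp: vge_def)

lemma vgt_mono: "vgt g x \<Longrightarrow> h \<le> g \<Longrightarrow> vgt h x"
  by (auto simp: vgt_def)

lemma vge_uminus [simp]: "vge g (- x) = vge g x"
  by (auto simp: vge_def)

lemma vgt_uminus [simp]: "vgt g (- x) = vgt g x"
  by (auto simp: vgt_def)

lemma vge_add:
  assumes "vge g x" "vge g y" shows "vge g (x + y)"
proof (cases "x = 0 \<or> y = 0 \<or> x + y = 0")
  case False
  then show ?thesis using assms v_add[of x y] by (auto simp: vge_def min_def split: if_splits)
qed (use assms in auto)

lemma vgt_add: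
  assumes "vgt g x" "vgt g y" shows "vgt g (x + y)"
proof (cases "x = 0 \<or> y = 0 \<or> x + y = 0")
  case False
  then show ?thesis using assms v_add[of x y] by (auto simp: vgt_def min_def split: if_splits)
qed (use assms in auto)

lemma vgt_diff: "vgt g x \<Longrightarrow> vgt g y \<Longrightarrow> vgt g (x - y)"
  using vgt_add[of g x "- y"] by simp

lemma vge_mult: "vge g x \<Longrightarrow> vge h y \<Longrightarrow> vge (g + h) (x * y)"
  by (cases "x = 0 \<or> y = 0") (auto simp: vge_def v_mult add_mono)

lemma vgt_mult_left: "vgt g x \<Longrightarrow> vge h y \<Longrightarrow> vgt (g + h) (x * y)"
  by (cases "x = 0 \<or> y = 0") (auto simp: vge_def vgt_def v_mult add_less_le_mono)

lemma vgt_mult_right: "vge g x \<Longrightarrow> vgt h y \<Longrightarrow> vgt (g + h) (x * y)"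
  by (cases "x = 0 \<or> y = 0") (auto simp: vge_def vgt_def v_mult add_le_less_mono)

lemma vge_sum: "(\<And>i. i \<in> S \<Longrightarrow> vge g (f i)) \<Longrightarrow> vge g (sum f S)"
  by (induction S rule: infinite_finite_induct) (auto intro: vge_add)

lemma vgt_sum: "(\<And>i. i \<in> S \<Longrightarrow> vgt g (f i)) \<Longrightarrow> vgt g (sum f S)"
  by (induction S rule: infinite_finite_induct) (auto intro: vgt_add)

lemma vge_one [simp]: "vge 0 1"
  by (simp add: vge_def)

lemma vge_0_mult: "vge 0 x \<Longrightarrow> vge 0 y \<Longrightarrow> vge 0 (x * y)"
  using vge_mult[of 0 x 0 y] by simp

lemma vge_two: "vge 0 2"
  using vge_add[of 0 1 1] by simp

lemma unit_one_plus:
  assumes "vgt 0 x" shows "1 + x \<noteq> 0" "v (1 + x) = 0"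
proof -
  show nz: "1 + x \<noteq> 0"
  proof
    assume "1 + x = 0"
    then have "x = -1" by (metis add.commute eq_neg_iff_add_eq_0)
    then show False using assms by (simp add: vgt_def)
  qed
  have "vge 0 (1 + x)" using assms vge_add[of 0 1 x] vgt_imp_vge by simp
  moreover have "\<not> vgt 0 (1 + x)"
    using vgt_diff[of 0 "1 + x" x] assms by (auto simp: vgt_def)
  ultimately show "v (1 + x) = 0" using nz by (auto simp: vge_def vgt_def)
qed

lemma unit_mult: 
  assumes "x \<noteq> 0" "v x = 0" "y \<noteq> 0" "v y = 0"
  shows "x * y \<noteq> 0" "v (x * y) = 0"
  using assms v_mult by auto

lemma vge_divide_unit: "vge g x \<Longrightarrow> y \<noteq> 0 \<Longrightarrow> v y = 0 \<Longrightarrow> vge g (x / y)"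
  by (cases "x = 0") (auto simp: vge_def val_divide)

lemma vgt_divide_unit: "vgt g x \<Longrightarrow> y \<noteq> 0 \<Longrightarrow> v y = 0 \<Longrightarrow> vgt g (x / y)"
  by (cases "x = 0") (auto simp: vgt_def val_divide)

lemma vgt_divide: "vgt g x \<Longrightarrow> y \<noteq> 0 \<Longrightarrow> vgt (g - v y) (x / y)"
  by (cases "x = 0") (auto simp: vgt_def val_divide)

lemma vge_divide: "vge g x \<Longrightarrow> y \<noteq> 0 \<Longrightarrow> vge (g - v y) (x / y)"
  by (cases "x = 0") (auto simp: vge_def val_divide diff_right_mono)

end

context two_henselian
begin

lemma val_two_nonneg: "0 \<le> v 2"
  using vge_two two_nonzero by (auto simp: vge_def)

text \<open>
  The leading coefficient \<open>c\<close> need not be a unit.  Multiplication by \<open>c\<close> and the substitution \<open>w = c s\<close>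
  give the monic polynomial \<open>w\<^sup>2 + w + c e\<close>, whose derivative is \<open>1\<close> at the approximate root \<open>0\<close>.  The
  solution \<open>s\<close> is recovered from \<open>w\<close> without dividing by \<open>c\<close>, which may be \<open>0\<close>.
\<close>

lemma quadratic_root_monic:
  assumes "vge 0 c" "vgt 0 e"
  shows "\<exists>s. vgt 0 s \<and> s + c * s^2 + e = 0"
proof -
  have ce: "vgt 0 (c * e)" using vgt_mult_right[OF assms] by simp
  let ?f = "[:c * e, 1, 1:]"
  have "\<forall>i. coeff ?f i \<in> carrier (valring v)"
    using vgt_imp_vge[OF ce] by (auto simp: valring_def coeff_pCons vge_def split: nat.split)
  then have "\<exists>b \<in> carrier (valring v). poly ?f b = 0 \<and> b - 0 \<in> val_ideal v 0"
    by (intro hensel2) (use ce in \<open>auto simp: valring_def val_ideal_def vgt_def pderiv_pCons\<close>)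
  then obtain w where w: "c * e + w + w^2 = 0" "vgt 0 w"
    by (auto simp: val_ideal_def vgt_def algebra_simps power2_eq_square)
  note u = unit_one_plus[OF w(2)]
  define s where "s = - e / (1 + w)"
  have s: "s * (1 + w) = - e" using u by (simp add: s_def)
  have "- (c * e) = w + w^2" using w(1) by (simp add: neg_eq_iff_add_eq_0 add.assoc)
  then have "c * (s * (1 + w)) = w * (1 + w)"
    unfolding s by (simp add: algebra_simps power2_eq_square)
  then have "c * s * (1 + w) = w * (1 + w)" by (simp add: mult.assoc)
  then have "c * s = w" using u by simp
  then have "s + c * s^2 + e = s * (1 + w) + e"
    by (simp add: algebra_simps power2_eq_square)
  then have "s + c * s^2 + e = 0" using s by simp
  moreover have "vgt 0 s" using assms u by (simp add: s_def vgt_divide_unit)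
  ultimately show ?thesis by blast
qed

text \<open>
  With \<open>t = 2 s\<close> every term becomes divisible by \<open>4\<close>.
\<close>

lemma quadratic_root:
  assumes "vge 0 c" "vgt (v 2 + v 2) d"
  shows "\<exists>t. vgt (v 2) t \<and> 2 * t + c * t^2 + d = 0"
proof -
  have four: "(4::'k) = 2 * 2" by simp
  then have four0: "(4::'k) \<noteq> 0" using two_nonzero by (metis mult_eq_0_iff)
  have v4: "v 4 = v 2 + v 2" unfolding four by (rule v_mult[OF two_nonzero two_nonzero])
  have "vgt 0 (d / 4)" using vgt_divide[OF assms(2) four0] v4 by simp
  then obtain s where s: "vgt 0 s" "s + c * s^2 + d / 4 = 0"
    using quadratic_root_monic assms(1) by blast
  have "2 * (2 * s) + c * (2 * s)^2 + d = 4 * (s + c * s^2 + d / 4)"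
    using four0 by (simp add: distrib_left power2_eq_square)
  moreover have "vgt (v 2) (2 * s)" using vgt_mult_right[of "v 2" 2 0 s] s by (simp add: vge_def)
  ultimately show ?thesis using s by auto
qed

text \<open>
  The quotient \<open>a' / a\<close> is of the form \<open>1 + d\<close> with \<open>v d > 2 v 2\<close>, hence the square of a unit \<open>1 + t\<close>.
\<close>

lemma rank_one_solution:
  assumes "a \<noteq> 0" "vgt (v a + (v 2 + v 2)) (a' - a)"
  shows "\<exists>x. x \<noteq> 0 \<and> v x = 0 \<and> x * a' * x = a"
proof -
  have "vgt (v 2 + v 2) ((a' - a) / a)" using vgt_divide[OF assms(2,1)] by simp
  then have "vgt (v 2 + v 2) (- ((a' - a) / a))" by simp
  then obtain t where t: "vgt (v 2) t" "2 * t + 1 * t^2 + (- ((a' - a) / a)) = 0"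
    using quadratic_root[OF vge_one] by blast
  have "vgt 0 t" using t vgt_mono val_two_nonneg by blast
  note u = unit_one_plus[OF this]
  have "(1 + t)^2 = 1 + (2 * t + t^2)" by (simp add: power2_eq_square algebra_simps)
  also have "\<dots> = 1 + (a' - a) / a" using t(2) by simp
  also have "\<dots> = a' / a" using assms(1) by (simp add: diff_divide_distrib)
  finally have sq: "(1 + t) * (1 + t) * a = a'" using assms(1) by (simp add: power2_eq_square)
  have "1 / (1 + t) * a' * (1 / (1 + t)) = a" unfolding sq[symmetric] using u by simp
  moreover have "v (1 / (1 + t)) = 0" "1 / (1 + t) \<noteq> 0" using u val_inverse by (auto simp: divide_inverse)
  ultimately show ?thesis by blast
qed

text \<open>
  In a plane with Gram matrix \<open>(\<alpha>', \<beta>; \<beta>, \<kappa>')\<close> the vectors with coordinates \<open>(1, t)\<close> and \<open>(\<tau>, w)\<close> form a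
  basis with Gram matrix \<open>(\<alpha>, 1; 1, \<kappa>)\<close>.  Since the diagonal entries lie in the maximal ideal, adding a
  multiple of one basis vector to the other changes the norm of the latter by \<open>2 t\<close> times a unit plus a
  smaller quadratic term, so that the two norms can be corrected one after the other.
\<close>

lemma plane_solution_normalised:
  assumes al: "vgt 0 \<alpha>" and ka: "vgt 0 \<kappa>"
    and da: "vgt (v 2 + v 2) (\<alpha>' - \<alpha>)" and db: "vgt (v 2 + v 2) (\<beta> - 1)"
    and dk: "vgt (v 2 + v 2) (\<kappa>' - \<kappa>)"
  shows "\<exists>t \<tau> w. vge 0 t \<and> vge 0 \<tau> \<and> vge 0 w \<and> w - \<tau> * t \<noteq> 0 \<and> v (w - \<tau> * t) = 0 \<and>
     \<alpha>' + 2 * \<beta> * t + \<kappa>' * t^2 = \<alpha> \<and>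
     \<alpha>' * \<tau> + \<beta> * w + \<beta> * t * \<tau> + \<kappa>' * t * w = 1 \<and>
     \<alpha>' * \<tau>^2 + 2 * \<beta> * \<tau> * w + \<kappa>' * w^2 = \<kappa>"
proof -
  note v2 = val_two_nonneg
  have v22: "0 \<le> v 2 + v 2" using v2 by simp
  have al': "vgt 0 \<alpha>'" using vgt_add[OF al vgt_mono[OF da v22]] by simp
  have ka': "vgt 0 \<kappa>'" using vgt_add[OF ka vgt_mono[OF dk v22]] by simp
  have ub: "\<beta> \<noteq> 0" "v \<beta> = 0" using unit_one_plus[OF vgt_mono[OF db v22]] by auto
  \<comment> \<open>For basis vectors \<open>x\<close>, \<open>y\<close> of the given plane, \<open>x + t y\<close> gets norm \<open>\<alpha>\<close>.\<close>
  have "vgt (v 2 + v 2) ((\<alpha>' - \<alpha>) / \<beta>)" "vge 0 (\<kappa>' / \<beta>)"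
    using da ka' ub vgt_divide_unit vge_divide_unit vgt_imp_vge by blast+
  from quadratic_root[OF this(2,1)] obtain t where
    t: "vgt (v 2) t" "2 * t + \<kappa>' / \<beta> * t^2 + (\<alpha>' - \<alpha>) / \<beta> = 0" by blast
  have "\<alpha>' + 2 * \<beta> * t + \<kappa>' * t^2 - \<alpha> = \<beta> * (2 * t + \<kappa>' / \<beta> * t^2 + (\<alpha>' - \<alpha>) / \<beta>)"
    using ub(1) by (simp add: distrib_left)
  then have n1: "\<alpha>' + 2 * \<beta> * t + \<kappa>' * t^2 = \<alpha>" using t(2) by simp
  have t0: "vgt 0 t" using t v2 vgt_mono by blast
  have kt: "vgt (v 2) (\<kappa>' * t)" using vgt_mult_right[OF vgt_imp_vge[OF ka'] t(1)] by simp
  \<comment> \<open>The product of \<open>x + t y\<close> with \<open>y\<close>.  It is \<open>1\<close> modulo \<open>2\<close> times the maximal ideal; its square, by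
    which the norm of \<open>y\<close> is divided in \<open>y / \<beta>\<^sub>1\<close>, is even \<open>1\<close> modulo \<open>4\<close> times the maximal ideal.\<close>
  define \<beta>\<^sub>1 where "\<beta>\<^sub>1 = \<beta> + \<kappa>' * t"
  have "vgt 0 (\<beta> - 1 + \<kappa>' * t)" using vgt_add vgt_mono[OF db v22] vgt_mono[OF kt v2] by blast
  from unit_one_plus[OF this] have ub1: "\<beta>\<^sub>1 \<noteq> 0" "v \<beta>\<^sub>1 = 0" by (auto simp: \<beta>\<^sub>1_def algebra_simps)
  have b: "vge 0 \<beta>" using ub by (simp add: vge_def)
  have "vgt (v 2 + v 2) ((\<beta> - 1) * (\<beta> + 1))"
    using vgt_mult_left[OF db, of 0 "\<beta> + 1"] vge_add[OF b vge_one] by simp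
  moreover have "vgt (v 2 + v 2) (2 * (\<beta> * (\<kappa>' * t)))"
    using vgt_mult_right[of "v 2" 2 "v 2"] vgt_mult_right[OF b kt] by (simp add: vge_def)
  moreover have "vgt (v 2 + v 2) ((\<kappa>' * t) * (\<kappa>' * t))"
    using vgt_mult_right[OF vgt_imp_vge[OF kt] kt] .
  ultimately have "vgt (v 2 + v 2) ((\<beta> - 1) * (\<beta> + 1) + 2 * (\<beta> * (\<kappa>' * t)) + (\<kappa>' * t) * (\<kappa>' * t))"
    using vgt_add by blast
  also have "(\<beta> - 1) * (\<beta> + 1) + 2 * (\<beta> * (\<kappa>' * t)) + (\<kappa>' * t) * (\<kappa>' * t) = \<beta>\<^sub>1^2 - 1"
    by (simp add: \<beta>\<^sub>1_def algebra_simps power2_eq_square)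
  finally have sq: "vgt (v 2 + v 2) (\<beta>\<^sub>1^2 - 1)" .
  have ub2: "\<beta>\<^sub>1^2 \<noteq> 0" "v (\<beta>\<^sub>1^2) = 0" using unit_mult[OF ub1 ub1] by (auto simp: power2_eq_square)
  \<comment> \<open>The norm of \<open>y / \<beta>\<^sub>1\<close>, a vector whose product with \<open>x + t y\<close> is \<open>1\<close>.\<close>
  define \<kappa>\<^sub>1 where "\<kappa>\<^sub>1 = \<kappa>' / \<beta>\<^sub>1^2"
  have "vgt (v 2 + v 2) ((\<kappa>' - \<kappa>) - \<kappa> * (\<beta>\<^sub>1^2 - 1))"
    using vgt_diff dk vgt_mult_right[OF vgt_imp_vge[OF ka] sq] by simp
  moreover have "\<kappa>\<^sub>1 - \<kappa> = ((\<kappa>' - \<kappa>) - \<kappa> * (\<beta>\<^sub>1^2 - 1)) / \<beta>\<^sub>1^2"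
    using ub2(1) by (simp add: \<kappa>\<^sub>1_def field_simps)
  ultimately have dk1: "vgt (v 2 + v 2) (\<kappa>\<^sub>1 - \<kappa>)" using vgt_divide_unit ub2 by metis
  have k1: "vgt 0 \<kappa>\<^sub>1" unfolding \<kappa>\<^sub>1_def using vgt_divide_unit ka' ub2 by blast
  have "vgt 0 (- (\<alpha> * \<kappa>\<^sub>1))" using vgt_mult_right[OF vgt_imp_vge[OF al] k1] by simp
  from unit_one_plus[OF this] have ud: "1 - \<alpha> * \<kappa>\<^sub>1 \<noteq> 0" "v (1 - \<alpha> * \<kappa>\<^sub>1) = 0" by auto
  have "vgt (v 2 + v 2) ((\<kappa>\<^sub>1 - \<kappa>) / (1 - \<alpha> * \<kappa>\<^sub>1))" using dk1 ud vgt_divide_unit by blast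
  moreover have "vge 0 (- \<alpha>)" using al vgt_imp_vge by simp
  ultimately obtain \<tau> where
    ta: "vgt (v 2) \<tau>" "2 * \<tau> + (- \<alpha>) * \<tau>^2 + (\<kappa>\<^sub>1 - \<kappa>) / (1 - \<alpha> * \<kappa>\<^sub>1) = 0"
    using quadratic_root by blast
  have ta0: "vgt 0 \<tau>" using ta v2 vgt_mono by blast
  have "(1 - \<alpha> * \<kappa>\<^sub>1) * (2 * \<tau> + (- \<alpha>) * \<tau>^2 + (\<kappa>\<^sub>1 - \<kappa>) / (1 - \<alpha> * \<kappa>\<^sub>1))
     = (1 - \<alpha> * \<kappa>\<^sub>1) * (2 * \<tau> + (- \<alpha>) * \<tau>^2) + (\<kappa>\<^sub>1 - \<kappa>)"
    using ud(1) by (simp only: distrib_left) simp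
  with ta(2) have e2: "(1 - \<alpha> * \<kappa>\<^sub>1) * (2 * \<tau> - \<alpha> * \<tau>^2) + (\<kappa>\<^sub>1 - \<kappa>) = 0" by simp
  have "vgt 0 (- (\<tau> * \<alpha>))" using vgt_mult_right[OF vgt_imp_vge[OF ta0] al] by simp
  from unit_one_plus[OF this] have ue: "1 - \<tau> * \<alpha> \<noteq> 0" "v (1 - \<tau> * \<alpha>) = 0" by auto
  \<comment> \<open>The second basis vector is \<open>\<tau> (x + t y) + (1 - \<tau> \<alpha>) y / \<beta>\<^sub>1\<close>: its product with \<open>x + t y\<close> is still \<open>1\<close>,
    and its norm is \<open>\<kappa>\<close> by the choice of \<open>\<tau>\<close>.\<close>
  define h where "h = (1 - \<tau> * \<alpha>) / \<beta>\<^sub>1"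
  define w where "w = \<tau> * t + h"
  have hb: "h * \<beta>\<^sub>1 = 1 - \<tau> * \<alpha>" using ub1 by (simp add: h_def)
  have uh: "h \<noteq> 0" "v h = 0" using ue ub1 val_divide by (auto simp: h_def)
  have "\<alpha>' * \<tau> + \<beta> * w + \<beta> * t * \<tau> + \<kappa>' * t * w
      = \<tau> * (\<alpha>' + 2 * \<beta> * t + \<kappa>' * t^2) + h * \<beta>\<^sub>1"
    by (simp add: w_def \<beta>\<^sub>1_def algebra_simps power2_eq_square)
  then have n2: "\<alpha>' * \<tau> + \<beta> * w + \<beta> * t * \<tau> + \<kappa>' * t * w = 1"
    using n1 hb by simp
  have "\<kappa>' * h^2 = \<kappa>\<^sub>1 * (h * \<beta>\<^sub>1)^2" using ub2(1) by (simp add: \<kappa>\<^sub>1_def power_mult_distrib)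
  then have kh: "\<kappa>' * h^2 = \<kappa>\<^sub>1 * (1 - \<tau> * \<alpha>)^2" using hb by simp
  have "\<alpha>' * \<tau>^2 + 2 * \<beta> * \<tau> * w + \<kappa>' * w^2
      = \<tau>^2 * (\<alpha>' + 2 * \<beta> * t + \<kappa>' * t^2) + 2 * \<tau> * (h * \<beta>\<^sub>1) + \<kappa>' * h^2"
    by (simp add: w_def \<beta>\<^sub>1_def algebra_simps power2_eq_square)
  also have "\<dots> = \<tau>^2 * \<alpha> + 2 * \<tau> * (1 - \<tau> * \<alpha>) + \<kappa>\<^sub>1 * (1 - \<tau> * \<alpha>)^2"
    unfolding n1 hb kh ..
  also have "\<dots> = (1 - \<alpha> * \<kappa>\<^sub>1) * (2 * \<tau> - \<alpha> * \<tau>^2) + (\<kappa>\<^sub>1 - \<kappa>) + \<kappa>"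
    by (simp add: algebra_simps power2_eq_square)
  finally have n3: "\<alpha>' * \<tau>^2 + 2 * \<beta> * \<tau> * w + \<kappa>' * w^2 = \<kappa>" using e2 by simp
  have "vge 0 h" using uh by (simp add: vge_def)
  then have "vge 0 w" unfolding w_def by (intro vge_add vge_0_mult vgt_imp_vge[OF ta0] vgt_imp_vge[OF t0])
  moreover have "w - \<tau> * t = h" by (simp add: w_def)
  ultimately show ?thesis
    using n1 n2 n3 uh vgt_imp_vge[OF t0] vgt_imp_vge[OF ta0]
    by (intro exI[of _ t] exI[of _ \<tau>] exI[of _ w]) simp
qed

end

section \<open>Congruence of symmetric matrices over the valuation ring\<close>

context valuation
begin

definition mge :: "'g \<Rightarrow> 'k mat \<Rightarrow> bool" where
  "mge g A \<longleftrightarrow> (\<forall>i < dim_row A. \<forall>j < dim_col A. vge g (A $$ (i, j)))"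

definition mgt :: "'g \<Rightarrow> 'k mat \<Rightarrow> bool" where
  "mgt g A \<longleftrightarrow> (\<forall>i < dim_row A. \<forall>j < dim_col A. vgt g (A $$ (i, j)))"

lemma mgt_mono: "mgt g A \<Longrightarrow> h \<le> g \<Longrightarrow> mgt h A"
  by (auto simp: mgt_def intro: vgt_mono)

lemma mge_zero [simp]: "mge g (0\<^sub>m n m)" and mgt_zero [simp]: "mgt g (0\<^sub>m n m)"
  by (auto simp: mge_def mgt_def)

lemma mge_one [simp]: "mge 0 (1\<^sub>m n)"
  by (auto simp: mge_def)

lemma mgt_diff: "A \<in> carrier_mat n m \<Longrightarrow> B \<in> carrier_mat n m \<Longrightarrow> mgt g A \<Longrightarrow> mgt g B \<Longrightarrow> mgt g (A - B)"
  by (auto simp: mgt_def intro: vgt_diff)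

lemma mge_transpose [simp]: "mge g (A\<^sup>T) = mge g A" and mgt_transpose [simp]: "mgt g (A\<^sup>T) = mgt g A"
  by (auto simp: mge_def mgt_def)

lemma mge_uminus [simp]: "mge g (- A) = mge g A"
  by (auto simp: mge_def)

lemma mge_mult:
  assumes "A \<in> carrier_mat n k" "B \<in> carrier_mat k m" "mge g A" "mge h B"
  shows "mge (g + h) (A * B)"
  using assms by (auto simp: mge_def scalar_prod_def intro!: vge_sum vge_mult)

lemma mgt_mult_left:
  assumes "A \<in> carrier_mat n k" "B \<in> carrier_mat k m" "mgt g A" "mge h B"
  shows "mgt (g + h) (A * B)"
  using assms by (auto simp: mge_def mgt_def scalar_prod_def intro!: vgt_sum vgt_mult_left)

lemma mgt_mult_right:
  assumes "A \<in> carrier_mat n k" "B \<in> carrier_mat k m" "mge g A" "mgt h B"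
  shows "mgt (g + h) (A * B)"
  using assms by (auto simp: mge_def mgt_def scalar_prod_def intro!: vgt_sum vgt_mult_right)

lemma mge_0_mult:
  assumes "A \<in> carrier_mat n k" "B \<in> carrier_mat k m" "mge 0 A" "mge 0 B"
  shows "mge 0 (A * B)"
  using mge_mult[OF assms] by simp

lemma mgt_four_block:
  assumes "A1 \<in> carrier_mat p r" "A2 \<in> carrier_mat p s" "A3 \<in> carrier_mat q r" "A4 \<in> carrier_mat q s"
  shows "mgt g (four_block_mat A1 A2 A3 A4) \<longleftrightarrow> mgt g A1 \<and> mgt g A2 \<and> mgt g A3 \<and> mgt g A4"
    (is "?L \<longleftrightarrow> ?R")
proof
  assume L: ?L
  have *: "vgt g (four_block_mat A1 A2 A3 A4 $$ (i, j))" if "i < p + q" "j < r + s" for i j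
    using L assms that by (auto simp: mgt_def)
  have "vgt g (A1 $$ (i, j))" if "i < p" "j < r" for i j
    using *[of i j] that assms by auto
  moreover have "vgt g (A2 $$ (i, j))" if "i < p" "j < s" for i j
    using *[of i "r + j"] that assms by auto
  moreover have "vgt g (A3 $$ (i, j))" if "i < q" "j < r" for i j
    using *[of "p + i" j] that assms by auto
  moreover have "vgt g (A4 $$ (i, j))" if "i < q" "j < s" for i j
    using *[of "p + i" "r + j"] that assms by auto
  ultimately show ?R using assms by (auto simp: mgt_def)
qed (use assms in \<open>auto simp: mgt_def\<close>)

lemma mge_four_block:
  assumes "A1 \<in> carrier_mat p r" "A2 \<in> carrier_mat p s" "A3 \<in> carrier_mat q r" "A4 \<in> carrier_mat q s"
  shows "mge g (four_block_mat A1 A2 A3 A4) \<longleftrightarrow> mge g A1 \<and> mge g A2 \<and> mge g A3 \<and> mge g A4"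
    (is "?L \<longleftrightarrow> ?R")
proof
  assume L: ?L
  have *: "vge g (four_block_mat A1 A2 A3 A4 $$ (i, j))" if "i < p + q" "j < r + s" for i j
    using L assms that by (auto simp: mge_def)
  have "vge g (A1 $$ (i, j))" if "i < p" "j < r" for i j
    using *[of i j] that assms by auto
  moreover have "vge g (A2 $$ (i, j))" if "i < p" "j < s" for i j
    using *[of i "r + j"] that assms by auto
  moreover have "vge g (A3 $$ (i, j))" if "i < q" "j < r" for i j
    using *[of "p + i" j] that assms by auto
  moreover have "vge g (A4 $$ (i, j))" if "i < q" "j < s" for i j
    using *[of "p + i" "r + j"] that assms by auto
  ultimately show ?R using assms by (auto simp: mge_def)
qed (use assms in \<open>auto simp: mge_def\<close>)

text \<open>
  Membership of \<open>X\<close> in \<open>GL\<^sub>n\<close> over the valuation ring, with the inverse as an explicit argument, since the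
  inverses of products and of the block matrices below are given by simple formulas.
\<close>

definition integral_inverses :: "nat \<Rightarrow> 'k mat \<Rightarrow> 'k mat \<Rightarrow> bool" where
  "integral_inverses n X Y \<longleftrightarrow> X \<in> carrier_mat n n \<and> Y \<in> carrier_mat n n \<and>
     mge 0 X \<and> mge 0 Y \<and> X * Y = 1\<^sub>m n \<and> Y * X = 1\<^sub>m n"

definition congruent :: "nat \<Rightarrow> 'k mat \<Rightarrow> 'k mat \<Rightarrow> bool" where
  "congruent n A B \<longleftrightarrow> (\<exists>X Y. integral_inverses n X Y \<and> A = X\<^sup>T * B * X)"

lemma integral_inverses_sym: "integral_inverses n X Y \<Longrightarrow> integral_inverses n Y X"
  by (auto simp: integral_inverses_def)

lemma integral_inverses_mult:
  assumes "integral_inverses n X Y" "integral_inverses n X' Y'"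
  shows "integral_inverses n (X * X') (Y' * Y)"
proof -
  note c = assms[unfolded integral_inverses_def]
  then have C: "X \<in> carrier_mat n n" "Y \<in> carrier_mat n n" "X' \<in> carrier_mat n n" "Y' \<in> carrier_mat n n"
    by auto
  have "X * X' * (Y' * Y) = X * (X' * Y') * Y"
    using C by (simp add: assoc_mult_mat[of _ n n _ n _ n])
  moreover have "Y' * Y * (X * X') = Y' * (Y * X) * X'"
    using C by (simp add: assoc_mult_mat[of _ n n _ n _ n])
  ultimately show ?thesis
    using c C by (auto simp: integral_inverses_def intro: mge_0_mult)
qed

lemma congruence_trans:
  fixes X :: "'k mat"
  assumes "X \<in> carrier_mat n n" "Y \<in> carrier_mat n n" "B \<in> carrier_mat n n"
  shows "Y\<^sup>T * (X\<^sup>T * B * X) * Y = (X * Y)\<^sup>T * B * (X * Y)"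
  using assms by (simp add: transpose_mult[of _ n n _ n] assoc_mult_mat[of _ n n _ n _ n])

lemma congruent_trans:
  assumes "congruent n A B" "congruent n B C" "C \<in> carrier_mat n n"
  shows "congruent n A C"
proof -
  obtain X Y where X: "integral_inverses n X Y" "A = X\<^sup>T * B * X"
    using assms by (auto simp: congruent_def)
  obtain X' Y' where X': "integral_inverses n X' Y'" "B = X'\<^sup>T * C * X'"
    using assms by (auto simp: congruent_def)
  have "A = (X' * X)\<^sup>T * C * (X' * X)"
    unfolding X(2) X'(2) using congruence_trans X(1) X'(1) assms(3)
    by (auto simp: integral_inverses_def)
  then show ?thesis using integral_inverses_mult[OF X'(1) X(1)] by (auto simp: congruent_def)
qed

lemma congruent_sym:
  assumes "congruent n A B" "B \<in> carrier_mat n n" shows "congruent n B A"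
proof -
  obtain X Y where X: "integral_inverses n X Y" "A = X\<^sup>T * B * X"
    using assms by (auto simp: congruent_def)
  have "Y\<^sup>T * A * Y = (X * Y)\<^sup>T * B * (X * Y)"
    unfolding X(2) using congruence_trans X(1) assms(2) by (auto simp: integral_inverses_def)
  also have "\<dots> = B" using X(1) assms(2) by (auto simp: integral_inverses_def)
  finally show ?thesis using integral_inverses_sym[OF X(1)] by (auto simp: congruent_def)
qed

lemma symmetric_congruence:
  fixes X :: "'k mat"
  assumes "X \<in> carrier_mat n m" "B \<in> carrier_mat n n" "B\<^sup>T = B"
  shows "(X\<^sup>T * B * X)\<^sup>T = X\<^sup>T * B * X"
  using assms by (simp add: transpose_mult[of _ m n _ m] transpose_mult[of _ n n _ m] 
      assoc_mult_mat[of _ m n _ n _ m])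

lemma simultaneous_permutation:
  assumes pi: "\<pi> permutes {..<n}"
  shows "\<exists>X Y. integral_inverses n X Y \<and>
    (\<forall>A \<in> carrier_mat n n. X\<^sup>T * A * X = mat n n (\<lambda>(i, j). A $$ (\<pi> i, \<pi> j)))"
proof -
  define X where "X = mat n n (\<lambda>(i, j). if i = \<pi> j then 1 else 0 :: 'k)"
  have X: "X \<in> carrier_mat n n" by (simp add: X_def)
  have lt: "\<pi> i < n" if "i < n" for i using permutes_in_image[OF pi, of i] that by simp
  have inj: "\<pi> i = \<pi> j \<longleftrightarrow> i = j" for i j using permutes_inj[OF pi] by (auto dest: injD)
  have T: "X\<^sup>T * X = 1\<^sub>m n"
    by (rule eq_matI) (auto simp: X_def scalar_prod_def lt inj if_distrib[of "\<lambda>x. x * _"] cong: if_cong)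
  have T': "X * X\<^sup>T = 1\<^sub>m n"
  proof (rule eq_matI)
    fix i j assume "i < dim_row (1\<^sub>m n :: 'k mat)" "j < dim_col (1\<^sub>m n :: 'k mat)"
    then have ij: "i < n" "j < n" by auto
    obtain i' where i': "i' < n" "i = \<pi> i'" 
      using permutes_image[OF pi] ij by (metis imageE lessThan_iff)
    show "(X * X\<^sup>T) $$ (i, j) = 1\<^sub>m n $$ (i, j)"
      using ij i' by (simp add: X_def scalar_prod_def inj eq_commute[of j] if_distrib[of "\<lambda>x. x * _"] cong: if_cong)
  qed (auto simp: X_def)
  have m: "mge 0 X" by (auto simp: mge_def X_def)
  have E: "X\<^sup>T * A * X = mat n n (\<lambda>(i, j). A $$ (\<pi> i, \<pi> j))" if A: "A \<in> carrier_mat n n" for A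
  proof (rule eq_matI)
    fix i j assume "i < dim_row (mat n n (\<lambda>(i, j). A $$ (\<pi> i, \<pi> j)))"
      "j < dim_col (mat n n (\<lambda>(i, j). A $$ (\<pi> i, \<pi> j)))"
    then have ij: "i < n" "j < n" by auto
    have XA: "(X\<^sup>T * A) $$ (i, l) = A $$ (\<pi> i, l)" if "l < n" for l
      using ij A that lt by (simp add: X_def scalar_prod_def if_distrib[of "\<lambda>x. x * _"] cong: if_cong)
    have "(X\<^sup>T * A * X) $$ (i, j) = (\<Sum>l = 0..<n. (X\<^sup>T * A) $$ (i, l) * X $$ (l, j))"
      using ij A X by (simp add: scalar_prod_def del: assoc_mult_mat)
    also have "\<dots> = (\<Sum>l = 0..<n. A $$ (\<pi> i, l) * X $$ (l, j))"
      using XA by (intro sum.cong) auto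
    also have "\<dots> = A $$ (\<pi> i, \<pi> j)"
      using ij lt by (simp add: X_def if_distrib[of "\<lambda>x. _ * x"] cong: if_cong)
    finally show "(X\<^sup>T * A * X) $$ (i, j) = mat n n (\<lambda>(i, j). A $$ (\<pi> i, \<pi> j)) $$ (i, j)"
      using ij by simp
  qed (use A X in auto)
  have "integral_inverses n X (X\<^sup>T)" using X T T' m by (auto simp: integral_inverses_def)
  then show ?thesis using E by blast
qed

lemma split_symmetric:
  assumes "A \<in> carrier_mat (p + q) (p + q)" "A\<^sup>T = A"
  obtains A1 A2 A4 where "A1 \<in> carrier_mat p p" "A2 \<in> carrier_mat p q" "A4 \<in> carrier_mat q q"
    "A1\<^sup>T = A1" "A4\<^sup>T = A4" "A = four_block_mat A1 A2 (A2\<^sup>T) A4" 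
    "A1 = mat p p (\<lambda>(i, j). A $$ (i, j))"
proof -
  have s: "A $$ (i, j) = A $$ (j, i)" if "i < p + q" "j < p + q" for i j
    using index_transpose_mat(1)[of j A i] assms that by auto
  show ?thesis
  proof (rule that)
    show "(mat p p (\<lambda>(i, j). A $$ (i, j)))\<^sup>T = mat p p (\<lambda>(i, j). A $$ (i, j))"
      by (rule eq_matI) (auto intro: s)
    show "(mat q q (\<lambda>(i, j). A $$ (p + i, p + j)))\<^sup>T = mat q q (\<lambda>(i, j). A $$ (p + i, p + j))"
      by (rule eq_matI) (auto intro: s)
    show "A = four_block_mat (mat p p (\<lambda>(i, j). A $$ (i, j))) (mat p q (\<lambda>(i, j). A $$ (i, p + j)))
       ((mat p q (\<lambda>(i, j). A $$ (i, p + j)))\<^sup>T) (mat q q (\<lambda>(i, j). A $$ (p + i, p + j)))"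
      using assms by (intro eq_matI) (auto intro: s)
  qed auto
qed

lemma minus_four_block_mat:
  fixes A1 :: "'k mat"
  assumes "A1 \<in> carrier_mat p r" "A2 \<in> carrier_mat p s" "A3 \<in> carrier_mat q r" "A4 \<in> carrier_mat q s"
   "B1 \<in> carrier_mat p r" "B2 \<in> carrier_mat p s" "B3 \<in> carrier_mat q r" "B4 \<in> carrier_mat q s"
  shows "four_block_mat A1 A2 A3 A4 - four_block_mat B1 B2 B3 B4 =
    four_block_mat (A1 - B1) (A2 - B2) (A3 - B3) (A4 - B4)" (is "?L = ?R")
  using assms by (intro eq_matI) auto

lemma four_block_mat_inject:
  assumes e: "four_block_mat A1 A2 A3 A4 = four_block_mat B1 B2 B3 B4"
    and "A1 \<in> carrier_mat p r" "A2 \<in> carrier_mat p s" "A3 \<in> carrier_mat q r" "A4 \<in> carrier_mat q s"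
   "B1 \<in> carrier_mat p r" "B2 \<in> carrier_mat p s" "B3 \<in> carrier_mat q r" "B4 \<in> carrier_mat q s"
 shows "A1 = B1" "A2 = B2" "A3 = B3" "A4 = B4"
proof -
  have *: "four_block_mat A1 A2 A3 A4 $$ (i, j) = four_block_mat B1 B2 B3 B4 $$ (i, j)" for i j
    using e by simp
  show "A1 = B1" using assms *  by (intro eq_matI) (auto, metis index_mat_four_block(1) carrier_matD trans_less_add1)
  show "A4 = B4"
  proof (rule eq_matI)
    fix i j assume "i < dim_row B4" "j < dim_col B4"
    then show "A4 $$ (i, j) = B4 $$ (i, j)" using *[of "p + i" "r + j"] assms(2-) by simp
  qed (use assms in auto)
  show "A2 = B2"
  proof (rule eq_matI)
    fix i j assume "i < dim_row B2" "j < dim_col B2"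
    then show "A2 $$ (i, j) = B2 $$ (i, j)" using *[of i "r + j"] assms(2-) by simp
  qed (use assms in auto)
  show "A3 = B3"
  proof (rule eq_matI)
    fix i j assume "i < dim_row B3" "j < dim_col B3"
    then show "A3 $$ (i, j) = B3 $$ (i, j)" using *[of "p + i" j] assms(2-) by simp
  qed (use assms in auto)
qed

lemma integral_inverses_diag:
  assumes "integral_inverses p X Y" "integral_inverses q X' Y'"
  shows "integral_inverses (p + q) (four_block_mat X (0\<^sub>m p q) (0\<^sub>m q p) X')
     (four_block_mat Y (0\<^sub>m p q) (0\<^sub>m q p) Y')"
  using assms unfolding integral_inverses_def
  by (auto simp: mge_four_block[of _ p p _ q _ q] mult_four_block_mat[of _ p p _ q _ q _ _ p _ q]
      right_mult_zero_mat[of _ p p] right_mult_zero_mat[of _ q q]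
      left_mult_zero_mat[of _ q q] left_mult_zero_mat[of _ p p])

lemma congruent_diag:
  assumes "congruent p A1 B1" "congruent q A4 B4" "B1 \<in> carrier_mat p p" "B4 \<in> carrier_mat q q"
  shows "congruent (p + q) (four_block_mat A1 (0\<^sub>m p q) (0\<^sub>m q p) A4)
     (four_block_mat B1 (0\<^sub>m p q) (0\<^sub>m q p) B4)"
proof -
  obtain X Y where X: "integral_inverses p X Y" "A1 = X\<^sup>T * B1 * X"
    using assms by (auto simp: congruent_def)
  obtain X' Y' where X': "integral_inverses q X' Y'" "A4 = X'\<^sup>T * B4 * X'"
    using assms by (auto simp: congruent_def)
  have C: "X \<in> carrier_mat p p" "X' \<in> carrier_mat q q"
    using X X' by (auto simp: integral_inverses_def)
  show ?thesis unfolding congruent_def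
  proof (intro exI conjI)
    show "integral_inverses (p + q) (four_block_mat X (0\<^sub>m p q) (0\<^sub>m q p) X')
     (four_block_mat Y (0\<^sub>m p q) (0\<^sub>m q p) Y')"
      by (rule integral_inverses_diag[OF X(1) X'(1)])
    show "four_block_mat A1 (0\<^sub>m p q) (0\<^sub>m q p) A4 =
      (four_block_mat X (0\<^sub>m p q) (0\<^sub>m q p) X')\<^sup>T * four_block_mat B1 (0\<^sub>m p q) (0\<^sub>m q p) B4 *
      four_block_mat X (0\<^sub>m p q) (0\<^sub>m q p) X'"
      unfolding X(2) X'(2) using C assms(3,4)
      by (simp add: transpose_four_block_mat[of _ p p _ q _ q] 
          mult_four_block_mat[of _ p p _ q _ q _ _ p _ q])
  qed
qed

lemma integral_inverses_unitriangular:
  assumes "Z \<in> carrier_mat p q" "mge 0 Z"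
  shows "integral_inverses (p + q) (four_block_mat (1\<^sub>m p) (- Z) (0\<^sub>m q p) (1\<^sub>m q))
     (four_block_mat (1\<^sub>m p) Z (0\<^sub>m q p) (1\<^sub>m q))"
proof -
  have "Z + - Z = 0\<^sub>m p q" "- 0\<^sub>m q q = (0\<^sub>m q q :: 'k mat)"
    using assms by (auto intro!: eq_matI)
  then show ?thesis
    using assms unfolding integral_inverses_def
    by (simp add: mge_four_block[of _ p p _ q _ q] mult_four_block_mat[of _ p p _ q _ q _ _ p _ q] 
       uminus_l_inv_mat[of _ p q])
qed

text \<open>
  The inverse \<open>W\<close> of a symmetric matrix is symmetric, so one block row operation and its transpose clear
  both off-diagonal blocks.
\<close>

lemma schur_complement:
  fixes A1 :: "'k mat"
  assumes C: "A1 \<in> carrier_mat p p" "A2 \<in> carrier_mat p q" "A4 \<in> carrier_mat q q" "W \<in> carrier_mat p p"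
    and s: "A1\<^sup>T = A1" and W: "A1 * W = 1\<^sub>m p"
  defines "T \<equiv> four_block_mat (1\<^sub>m p) (- (W * A2)) (0\<^sub>m q p) (1\<^sub>m q)"
  shows "T\<^sup>T * four_block_mat A1 A2 (A2\<^sup>T) A4 * T =
     four_block_mat A1 (0\<^sub>m p q) (0\<^sub>m q p) (A4 - A2\<^sup>T * W * A2)"
proof -
  let ?Z = "W * A2"
  have Z: "?Z \<in> carrier_mat p q" using C by simp
  have AZ: "A1 * ?Z = A2" 
    using assoc_mult_mat[OF C(1,4,2)] left_mult_one_mat[OF C(2)] W by simp
  then have "(A1 * ?Z)\<^sup>T = A2\<^sup>T" by simp
  then have ZA: "?Z\<^sup>T * A1 = A2\<^sup>T" using transpose_mult[OF C(1) Z] s by simp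
  have TT: "T\<^sup>T = four_block_mat (1\<^sub>m p) (0\<^sub>m p q) (- ?Z\<^sup>T) (1\<^sub>m q)"
    unfolding T_def using C Z 
    by (simp add: transpose_four_block_mat[of _ p p _ q _ q] transpose_uminus)
  have "T\<^sup>T * four_block_mat A1 A2 (A2\<^sup>T) A4 = four_block_mat A1 A2 (- ?Z\<^sup>T * A1 + A2\<^sup>T) (- ?Z\<^sup>T * A2 + A4)"
    unfolding TT using C Z
    by (subst mult_four_block_mat[of _ p p _ q _ q _ _ p _ q]) auto
  also have "- ?Z\<^sup>T * A1 + A2\<^sup>T = 0\<^sub>m q p"
    using C Z ZA uminus_mult_left_mat[of "?Z\<^sup>T" A1] by (simp add: uminus_l_inv_mat[of _ q p])
  finally have 1: "T\<^sup>T * four_block_mat A1 A2 (A2\<^sup>T) A4 = 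
     four_block_mat A1 A2 (0\<^sub>m q p) (- ?Z\<^sup>T * A2 + A4)" .
  have "A1 * (- ?Z) + A2 = 0\<^sub>m p q"
    using C Z AZ uminus_mult_right_mat[of A1 ?Z] by (simp add: uminus_l_inv_mat[of _ p q])
  then have 2: "four_block_mat A1 A2 (0\<^sub>m q p) (- ?Z\<^sup>T * A2 + A4) * T = 
    four_block_mat A1 (0\<^sub>m p q) (0\<^sub>m q p) (- ?Z\<^sup>T * A2 + A4)"
    unfolding T_def using C Z
    by (subst mult_four_block_mat[of _ p p _ q _ q _ _ p _ q]) auto
  have "W\<^sup>T = W\<^sup>T * (A1 * W)" using C W by simp
  also have "\<dots> = (A1 * W)\<^sup>T * W"
    using C s by (simp add: transpose_mult[of _ p p _ p] assoc_mult_mat[of _ p p _ p _ p])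
  finally have WT: "W\<^sup>T = W" using W C by simp
  have "?Z\<^sup>T * A2 = A2\<^sup>T * W * A2" using C WT by (simp add: transpose_mult[of _ p p _ q])
  then have "- ?Z\<^sup>T * A2 + A4 = A4 - A2\<^sup>T * W * A2"
    using C Z uminus_mult_left_mat[of "?Z\<^sup>T" A2] by (intro eq_matI) auto
  then show ?thesis using 1 2 by simp
qed

end

section \<open>Elimination with a pivot of minimal value\<close>

context valuation
begin

text \<open>
  The matrix \<open>C\<close> is \<open>s A\<^sup>-\<^sup>1\<close>.  Its integrality says that \<open>s\<close> times the dual lattice is contained in the
  lattice; it bounds the values of all Jordan components without mentioning a decomposition, and it is
  inherited by orthogonal summands.
\<close>

definition close_forms :: "nat \<Rightarrow> 'k \<Rightarrow> 'g \<Rightarrow> 'k mat \<Rightarrow> 'k mat \<Rightarrow> bool" where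
  "close_forms n s \<gamma> A B \<longleftrightarrow> A \<in> carrier_mat n n \<and> B \<in> carrier_mat n n \<and> A\<^sup>T = A \<and> B\<^sup>T = B \<and>
     mgt \<gamma> (B - A) \<and> (\<exists>C \<in> carrier_mat n n. mge 0 C \<and> C * A = s \<cdot>\<^sub>m 1\<^sub>m n)"

text \<open>
  The role of \<open>C\<close> is taken over by \<open>Y C Y\<^sup>T\<close>.
\<close>

lemma close_forms_transport:
  assumes X: "integral_inverses n X Y" and close: "close_forms n s \<gamma> A B"
  shows "close_forms n s \<gamma> (X\<^sup>T * A * X) (X\<^sup>T * B * X)"
proof -
  obtain C where C: "C \<in> carrier_mat n n" "mge 0 C" "C * A = s \<cdot>\<^sub>m 1\<^sub>m n"
    using close by (auto simp: close_forms_def)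
  have c: "A \<in> carrier_mat n n" "B \<in> carrier_mat n n" "A\<^sup>T = A" "B\<^sup>T = B" "mgt \<gamma> (B - A)"
    using close by (auto simp: close_forms_def)
  have x: "X \<in> carrier_mat n n" "Y \<in> carrier_mat n n" "mge 0 X" "mge 0 Y" "X * Y = 1\<^sub>m n" "Y * X = 1\<^sub>m n"
    using X by (auto simp: integral_inverses_def)
  have YX: "Y\<^sup>T * X\<^sup>T = 1\<^sub>m n" using transpose_mult[OF x(1,2)] x(5) by simp
  have "Y * C * Y\<^sup>T * (X\<^sup>T * A * X) = Y * C * (Y\<^sup>T * X\<^sup>T) * A * X"
    using x(1,2) C(1) c(1) by (simp add: assoc_mult_mat[of _ n n _ n _ n])
  also have "\<dots> = Y * (C * A) * X"
    unfolding YX using x(1,2) C(1) c(1) by (simp add: assoc_mult_mat[of _ n n _ n _ n])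
  also have "\<dots> = s \<cdot>\<^sub>m (Y * X)"
    unfolding C(3) mult_smult_distrib[OF x(2) one_carrier_mat] right_mult_one_mat[OF x(2)]
    by (rule mult_smult_assoc_mat[OF x(2,1)])
  also have "\<dots> = s \<cdot>\<^sub>m 1\<^sub>m n" using x(6) by simp
  finally have 1: "Y * C * Y\<^sup>T * (X\<^sup>T * A * X) = s \<cdot>\<^sub>m 1\<^sub>m n" .
  have 2: "Y * C * Y\<^sup>T \<in> carrier_mat n n" using x C by simp
  have 3: "mge 0 (Y * C * Y\<^sup>T)"
    using x C by (intro mge_0_mult[of _ n n _ n]) auto
  have "X\<^sup>T * (B - A) * X = X\<^sup>T * B * X - X\<^sup>T * A * X"
    using x(1) c(1,2)
    by (simp add: mult_minus_distrib_mat[of _ n n _ n] minus_mult_distrib_mat[of _ n n _ _ n] del: assoc_mult_mat)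
  moreover have "mgt (0 + \<gamma> + 0) (X\<^sup>T * (B - A) * X)"
    using x c by (intro mgt_mult_left[of _ n n _ n] mgt_mult_right[of _ n n _ n]) auto
  ultimately have 4: "mgt \<gamma> (X\<^sup>T * B * X - X\<^sup>T * A * X)" by simp
  show ?thesis unfolding close_forms_def
    using 1 2 3 4 symmetric_congruence[OF x(1) c(1,3)] symmetric_congruence[OF x(1) c(2,4)] x(1) c(1,2)
    by (intro conjI bexI[of _ "Y * C * Y\<^sup>T"]) (auto simp del: assoc_mult_mat)
qed

lemma congruent_transport:
  assumes X: "integral_inverses n X Y" and A: "A \<in> carrier_mat n n" "B \<in> carrier_mat n n"
    and c: "congruent n (X\<^sup>T * A * X) (X\<^sup>T * B * X)"
  shows "congruent n A B"
proof -
  have "X \<in> carrier_mat n n" using X by (auto simp: integral_inverses_def)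
  have "congruent n (X\<^sup>T * A * X) A" "congruent n (X\<^sup>T * B * X) B"
    using X by (auto simp: congruent_def)
  then show ?thesis using congruent_sym congruent_trans c A by metis
qed

text \<open>
  Suppose the pivot block \<open>A1\<close> is already split off in \<open>A\<close>.  In \<open>B\<close> the off-diagonal block \<open>E2\<close> is then small
  (value above \<open>\<gamma>\<close>).  Splitting it off changes the complement by \<open>E2\<^sup>T W E2\<close>; as \<open>W\<close> lowers values by
  at most \<open>\<beta> \<le> \<gamma>\<close>, the factor \<open>W E2\<close> is integral and the change has value above \<open>\<gamma>\<close>.  Hence the complements of \<open>A\<close> and \<open>B\<close>
  are close again.
\<close>

lemma pivot_step_split:
  assumes A1: "A1 \<in> carrier_mat p p" "A1\<^sup>T = A1" and A4: "A4 \<in> carrier_mat q q"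
    and W: "W \<in> carrier_mat p p" "A1 * W = 1\<^sub>m p" "mge (- \<beta>) W" and \<beta>: "\<beta> \<le> \<gamma>"
    and loc: "\<And>B1. B1 \<in> carrier_mat p p \<Longrightarrow> B1\<^sup>T = B1 \<Longrightarrow> mgt \<gamma> (B1 - A1) \<Longrightarrow> congruent p A1 B1"
    and IH: "\<And>D B. close_forms q s \<gamma> D B \<Longrightarrow> congruent q D B"
    and close: "close_forms (p + q) s \<gamma> (four_block_mat A1 (0\<^sub>m p q) (0\<^sub>m q p) A4) B"
  shows "congruent (p + q) (four_block_mat A1 (0\<^sub>m p q) (0\<^sub>m q p) A4) B"
proof -
  let ?A = "four_block_mat A1 (0\<^sub>m p q) (0\<^sub>m q p) A4"
  have Ac: "?A \<in> carrier_mat (p + q) (p + q)" using A1 A4 by simp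
  have B: "B \<in> carrier_mat (p + q) (p + q)" "B\<^sup>T = B" "?A\<^sup>T = ?A" "mgt \<gamma> (B - ?A)"
    using close by (auto simp: close_forms_def)
  obtain C where C: "C \<in> carrier_mat (p + q) (p + q)" "mge 0 C" "C * ?A = s \<cdot>\<^sub>m 1\<^sub>m (p + q)"
    using close by (auto simp: close_forms_def)
  have "four_block_mat A1 (0\<^sub>m p q) (0\<^sub>m q p) (A4\<^sup>T) = ?A"
    using B(3) A1 A4 by (simp add: transpose_four_block_mat[of _ p p _ q _ q])
  then have A4s: "A4\<^sup>T = A4"
    by (rule four_block_mat_inject(4)[of _ _ _ _ _ _ _ _ p p q q]) (use A1 A4 in auto)
  obtain B1 B2 B4 where Bs: "B1 \<in> carrier_mat p p" "B2 \<in> carrier_mat p q" "B4 \<in> carrier_mat q q"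
    "B1\<^sup>T = B1" "B4\<^sup>T = B4" and Beq: "B = four_block_mat B1 B2 (B2\<^sup>T) B4"
    using split_symmetric[OF B(1,2)] by metis
  have "B - ?A = four_block_mat (B1 - A1) (B2 - 0\<^sub>m p q) (B2\<^sup>T - 0\<^sub>m q p) (B4 - A4)"
    unfolding Beq using A1 A4 Bs by (intro minus_four_block_mat) auto
  moreover have "B2 - 0\<^sub>m p q = B2" using Bs by (intro eq_matI) auto
  moreover have "B2\<^sup>T - 0\<^sub>m q p \<in> carrier_mat q p" by (rule minus_carrier_mat) simp
  ultimately have d: "mgt \<gamma> (B1 - A1)" "mgt \<gamma> B2" "mgt \<gamma> (B4 - A4)"
    using B(4) mgt_four_block[of "B1 - A1" p p B2 q "B2\<^sup>T - 0\<^sub>m q p" q "B4 - A4" \<gamma>] Bs(2)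
      minus_carrier_mat[OF A1(1)] minus_carrier_mat[OF A4]
    by auto
  \<comment> \<open>A base change of the first block makes the upper left block of \<open>B\<close> equal to that of \<open>A\<close>.\<close>
  obtain X Y where X: "integral_inverses p X Y" "A1 = X\<^sup>T * B1 * X"
    using loc[OF Bs(1,4) d(1)] by (auto simp: congruent_def)
  then have Xc: "X \<in> carrier_mat p p" "mge 0 X" by (auto simp: integral_inverses_def)
  define E2 where "E2 = X\<^sup>T * B2"
  have E2: "E2 \<in> carrier_mat p q" using Xc Bs by (simp add: E2_def)
  have "mgt (0 + \<gamma>) E2" unfolding E2_def using Xc Bs d by (intro mgt_mult_right[of _ p p _ q]) auto
  then have dE: "mgt \<gamma> E2" by simp
  define P where "P = four_block_mat X (0\<^sub>m p q) (0\<^sub>m q p) (1\<^sub>m q)"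
  have "integral_inverses q (1\<^sub>m q) (1\<^sub>m q)" by (simp add: integral_inverses_def)
  then have P: "\<exists>Q. integral_inverses (p + q) P Q"
    unfolding P_def using integral_inverses_diag[OF X(1)] by blast
  have E2T: "B2\<^sup>T * X = E2\<^sup>T" unfolding E2_def using Xc Bs transpose_mult[of "X\<^sup>T" p p B2 q] by simp
  have "P\<^sup>T * B * P = four_block_mat A1 E2 (E2\<^sup>T) B4"
    unfolding P_def Beq using Xc Bs X(2) E2T
    by (simp add: transpose_four_block_mat[of _ p p _ q _ q] E2_def
          mult_four_block_mat[of _ p p _ q _ q _ _ p _ q])
  with P have cong1: "congruent (p + q) (four_block_mat A1 E2 (E2\<^sup>T) B4) B"
    unfolding congruent_def by metis
  \<comment> \<open>Clearing the off-diagonal blocks is integral because \<open>- \<beta> + \<gamma> \<ge> 0\<close>.\<close>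
  let ?S = "B4 - E2\<^sup>T * W * E2"
  have "mgt (- \<beta> + \<gamma>) (W * E2)" using W E2 dE by (intro mgt_mult_right[of _ p p _ q]) auto
  then have "mgt 0 (W * E2)" using \<beta> by (auto elim: mgt_mono)
  then have WE: "mge 0 (W * E2)" by (auto simp: mge_def mgt_def intro: vgt_imp_vge)
  have ct: "integral_inverses (p + q) (four_block_mat (1\<^sub>m p) (- (W * E2)) (0\<^sub>m q p) (1\<^sub>m q))
     (four_block_mat (1\<^sub>m p) (W * E2) (0\<^sub>m q p) (1\<^sub>m q))"
    by (rule integral_inverses_unitriangular) (use W E2 WE in auto)
  have cong2: "congruent (p + q) (four_block_mat A1 (0\<^sub>m p q) (0\<^sub>m q p) ?S) (four_block_mat A1 E2 (E2\<^sup>T) B4)"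
    unfolding congruent_def using ct schur_complement[OF A1(1) E2 Bs(3) W(1) A1(2) W(2)] by metis
  \<comment> \<open>The complements are close forms for the same \<open>s\<close>; the lower right block of \<open>C\<close> is the witness.\<close>
  have Sc: "?S \<in> carrier_mat q q"
    by (rule minus_carrier_mat) (use E2 W in \<open>auto simp: assoc_mult_mat[of _ q p _ p _ q]\<close>)
  have "mgt (\<gamma> + 0) (E2\<^sup>T * (W * E2))" using E2 W dE WE by (intro mgt_mult_left[of _ q p _ q]) auto
  then have dd: "mgt \<gamma> (E2\<^sup>T * W * E2)" using E2 W by (simp add: assoc_mult_mat[of _ q p _ p _ q])
  have "(B4 - A4) - E2\<^sup>T * W * E2 = ?S - A4"
    using E2 W Bs A4 by (intro eq_matI) auto
  then have dS: "mgt \<gamma> (?S - A4)" 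
    using mgt_diff[OF minus_carrier_mat[OF A4] _ d(3) dd] E2 W by auto
  have "(four_block_mat A1 (0\<^sub>m p q) (0\<^sub>m q p) ?S)\<^sup>T = four_block_mat A1 (0\<^sub>m p q) (0\<^sub>m q p) ?S"
  proof -
    have B': "four_block_mat A1 E2 (E2\<^sup>T) B4 \<in> carrier_mat (p + q) (p + q)"
      "(four_block_mat A1 E2 (E2\<^sup>T) B4)\<^sup>T = four_block_mat A1 E2 (E2\<^sup>T) B4"
      using A1 E2 Bs by (simp_all add: transpose_four_block_mat[of _ p p _ q _ q])
    then show ?thesis
      using symmetric_congruence[OF _ B'] ct
        schur_complement[OF A1(1) E2 Bs(3) W(1) A1(2) W(2)]
      unfolding integral_inverses_def by metis
  qed
  then have "four_block_mat A1 (0\<^sub>m p q) (0\<^sub>m q p) (?S\<^sup>T) = four_block_mat A1 (0\<^sub>m p q) (0\<^sub>m q p) ?S"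
    using A1 Sc by (simp add: transpose_four_block_mat[of _ p p _ q _ q])
  then have Ss: "?S\<^sup>T = ?S"
    by (rule four_block_mat_inject(4)[of _ _ _ _ _ _ _ _ p p q q]) (use A1 Sc in auto)
  obtain C1 C2 C3 C4 where Cs: "split_block C p p = (C1, C2, C3, C4)"
    by (metis prod_cases4)
  note Cb = split_block[OF Cs, of q q]
  have Cc: "C1 \<in> carrier_mat p p" "C2 \<in> carrier_mat p q" "C3 \<in> carrier_mat q p" "C4 \<in> carrier_mat q q"
    "C = four_block_mat C1 C2 C3 C4" using Cb C(1) by auto
  have "four_block_mat (C1 * A1) (C2 * A4) (C3 * A1) (C4 * A4) = C * ?A"
    unfolding Cc(5) using Cc(1-4) A1 A4
    by (subst mult_four_block_mat[of _ p p _ q _ q _ _ p _ q]) 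
      (auto simp: right_mult_zero_mat[of _ p p] right_mult_zero_mat[of _ p q] right_mult_zero_mat[of _ q p] right_mult_zero_mat[of _ q q])
  also have "\<dots> = four_block_mat (s \<cdot>\<^sub>m 1\<^sub>m p) (0\<^sub>m p q) (0\<^sub>m q p) (s \<cdot>\<^sub>m 1\<^sub>m q)"
    unfolding C(3) by (intro eq_matI) auto
  finally have C4A: "C4 * A4 = s \<cdot>\<^sub>m 1\<^sub>m q"
    by (rule four_block_mat_inject(4)[of _ _ _ _ _ _ _ _ p p q q]) (use Cc A1 A4 in auto)
  have "mge 0 C4" using C(2) Cc mge_four_block[OF Cc(1-4)] by simp
  then have "close_forms q s \<gamma> A4 ?S"
    unfolding close_forms_def using A4 A4s Sc Ss dS C4A Cc(4) by blast
  then have "congruent q A4 ?S" by (rule IH)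
  moreover have "congruent p A1 A1" unfolding congruent_def
    by (rule exI[of _ "1\<^sub>m p"], rule exI[of _ "1\<^sub>m p"]) (use A1 in \<open>auto simp: integral_inverses_def\<close>)
  ultimately have "congruent (p + q) ?A (four_block_mat A1 (0\<^sub>m p q) (0\<^sub>m q p) ?S)"
    using congruent_diag A1 Sc by blast
  moreover have "four_block_mat A1 E2 (E2\<^sup>T) B4 \<in> carrier_mat (p + q) (p + q)" using A1 Bs by simp
  ultimately show ?thesis using congruent_trans cong1 cong2 B(1) by metis
qed

text \<open>
  All entries of \<open>A\<close> have value at least \<open>\<beta>\<close> and those of \<open>W\<close> at least \<open>- \<beta>\<close>, so the base change that
  splits the pivot block off \<open>A\<close> is integral.  The same base change is applied to \<open>B\<close>.
\<close>

lemma pivot_step: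
  assumes close: "close_forms (p + q) s \<gamma> A B"
    and W: "W \<in> carrier_mat p p" "mat p p (\<lambda>(i, j). A $$ (i, j)) * W = 1\<^sub>m p" "mge (- \<beta>) W"
    and \<beta>: "\<beta> \<le> \<gamma>" and A\<beta>: "mge \<beta> A"
    and loc: "\<And>B1. B1 \<in> carrier_mat p p \<Longrightarrow> B1\<^sup>T = B1 \<Longrightarrow> 
        mgt \<gamma> (B1 - mat p p (\<lambda>(i, j). A $$ (i, j))) \<Longrightarrow> congruent p (mat p p (\<lambda>(i, j). A $$ (i, j))) B1"
    and IH: "\<And>D B. close_forms q s \<gamma> D B \<Longrightarrow> congruent q D B"
  shows "congruent (p + q) A B"
proof -
  have A: "A \<in> carrier_mat (p + q) (p + q)" "A\<^sup>T = A" and B: "B \<in> carrier_mat (p + q) (p + q)"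
    using close by (auto simp: close_forms_def)
  obtain A1 A2 A4 where As: "A1 \<in> carrier_mat p p" "A2 \<in> carrier_mat p q" "A4 \<in> carrier_mat q q"
    "A1\<^sup>T = A1" "A4\<^sup>T = A4" and Aeq: "A = four_block_mat A1 A2 (A2\<^sup>T) A4" 
    and A1: "A1 = mat p p (\<lambda>(i, j). A $$ (i, j))"
    using split_symmetric[OF A] by metis
  have W': "A1 * W = 1\<^sub>m p" using W A1 by simp
  have "mge \<beta> A2" using A\<beta> Aeq mge_four_block[of A1 p p A2 q "A2\<^sup>T" q A4 \<beta>] As by auto
  then have "mge (- \<beta> + \<beta>) (W * A2)" using W As by (intro mge_mult[of _ p p _ q]) auto
  then have ii: "integral_inverses (p + q) (four_block_mat (1\<^sub>m p) (- (W * A2)) (0\<^sub>m q p) (1\<^sub>m q))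
     (four_block_mat (1\<^sub>m p) (W * A2) (0\<^sub>m q p) (1\<^sub>m q))" (is "integral_inverses _ ?T ?T'")
    by (intro integral_inverses_unitriangular) (use W As in auto)
  have eq: "?T\<^sup>T * A * ?T = four_block_mat A1 (0\<^sub>m p q) (0\<^sub>m q p) (A4 - A2\<^sup>T * W * A2)"
    unfolding Aeq by (rule schur_complement) (use As W W' in auto)
  show ?thesis
  proof (rule congruent_transport[OF ii A(1) B])
    show "congruent (p + q) (?T\<^sup>T * A * ?T) (?T\<^sup>T * B * ?T)"
      unfolding eq
    proof (rule pivot_step_split[OF As(1,4) _ W(1) W' W(3) \<beta> loc[folded A1] IH])
      show "close_forms (p + q) s \<gamma> (four_block_mat A1 (0\<^sub>m p q) (0\<^sub>m q p) (A4 - A2\<^sup>T * W * A2)) (?T\<^sup>T * B * ?T)"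
        using close_forms_transport[OF ii close] unfolding eq .
    qed (use As W in auto)
  qed
qed

end

lemma mult_mat_2_2:
  "A \<in> carrier_mat 2 2 \<Longrightarrow> B \<in> carrier_mat 2 2 \<Longrightarrow> i < 2 \<Longrightarrow> j < 2 \<Longrightarrow>
   (A * B) $$ (i, j) = A $$ (i, 0) * B $$ (0, j) + A $$ (i, 1) * B $$ (1, j)"
  by (simp add: scalar_prod_def numeral_2_eq_2)

lemma eq_mat_2_2:
  assumes "A \<in> carrier_mat 2 2" "B \<in> carrier_mat 2 2"
    "A $$ (0, 0) = B $$ (0, 0)" "A $$ (0, 1) = B $$ (0, 1)" "A $$ (1, 0) = B $$ (1, 0)" "A $$ (1, 1) = B $$ (1, 1)"
  shows "A = B"
  by (rule eq_matI) (use assms in \<open>auto simp: less_2_cases_iff\<close>)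

context two_henselian
begin

lemma congruent_rank_one:
  assumes "A \<in> carrier_mat 1 1" "B \<in> carrier_mat 1 1" "A $$ (0, 0) \<noteq> 0"
    "mgt (v (A $$ (0, 0)) + (v 2 + v 2)) (B - A)"
  shows "congruent 1 A B"
proof -
  have "vgt (v (A $$ (0, 0)) + (v 2 + v 2)) (B $$ (0, 0) - A $$ (0, 0))"
    using assms by (auto simp: mgt_def)
  then obtain x where x: "x \<noteq> 0" "v x = 0" "x * B $$ (0, 0) * x = A $$ (0, 0)"
    using rank_one_solution[OF assms(3)] by blast
  let ?X = "mat 1 1 (\<lambda>_. x)" and ?Y = "mat 1 1 (\<lambda>_. inverse x)"
  have "integral_inverses 1 ?X ?Y"
    using x val_inverse[of x]
    by (auto simp: integral_inverses_def mge_def vge_def scalar_prod_def intro!: eq_matI)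
  moreover have "A = ?X\<^sup>T * B * ?X"
    using assms(1,2) x(3) by (intro eq_matI) (auto simp: scalar_prod_def)
  ultimately show ?thesis unfolding congruent_def by blast
qed

text \<open>
  After division by the off-diagonal entry \<open>b\<close> this is \<open>plane_solution_normalised\<close>; the columns of \<open>X\<close> are
  the coordinate vectors found there.
\<close>

lemma congruent_rank_two:
  assumes A: "A \<in> carrier_mat 2 2" "A\<^sup>T = A" and B: "B \<in> carrier_mat 2 2" "B\<^sup>T = B"
    and b: "A $$ (0, 1) \<noteq> 0" and diag: "vgt (v (A $$ (0, 1))) (A $$ (0, 0))" "vgt (v (A $$ (0, 1))) (A $$ (1, 1))"
    and d: "mgt (v (A $$ (0, 1)) + (v 2 + v 2)) (B - A)"
  shows "congruent 2 A B"
proof -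
  define b where "b = A $$ (0, 1)"
  have b0: "b \<noteq> 0" using b by (simp add: b_def)
  have d': "vgt (v b + (v 2 + v 2)) (B $$ (i, j) - A $$ (i, j))" if "i < 2" "j < 2" for i j
    using d that A B by (auto simp: mgt_def b_def)
  have d'': "vgt (v 2 + v 2) (B $$ (i, j) / b - A $$ (i, j) / b)" if "i < 2" "j < 2" for i j
    using vgt_divide[OF d'[OF that] b0] by (simp add: diff_divide_distrib)
  have symA: "A $$ (1, 0) = A $$ (0, 1)" and symB: "B $$ (1, 0) = B $$ (0, 1)"
    using A B index_transpose_mat(1)[of 0 A 1] index_transpose_mat(1)[of 0 B 1] by auto
  have "vgt 0 (A $$ (0, 0) / b)" "vgt 0 (A $$ (1, 1) / b)"
    using vgt_divide[OF diag(1) b] vgt_divide[OF diag(2) b] by (auto simp: b_def)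
  moreover have "vgt (v 2 + v 2) (B $$ (0, 1) / b - 1)" using d''[of 0 1] b0 by (simp add: b_def)
  ultimately obtain t \<tau> w where s: "vge 0 t" "vge 0 \<tau>" "vge 0 w" "w - \<tau> * t \<noteq> 0" "v (w - \<tau> * t) = 0"
     and e1: "B $$ (0, 0) / b + 2 * (B $$ (0, 1) / b) * t + B $$ (1, 1) / b * t^2 = A $$ (0, 0) / b"
     and e2: "B $$ (0, 0) / b * \<tau> + B $$ (0, 1) / b * w + B $$ (0, 1) / b * t * \<tau> + B $$ (1, 1) / b * t * w = 1"
     and e3: "B $$ (0, 0) / b * \<tau>^2 + 2 * (B $$ (0, 1) / b) * \<tau> * w + B $$ (1, 1) / b * w^2 = A $$ (1, 1) / b"
    using plane_solution_normalised[of "A $$ (0, 0) / b" "A $$ (1, 1) / b" "B $$ (0, 0) / b" "B $$ (0, 1) / b" "B $$ (1, 1) / b"]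
      d''[of 0 0] d''[of 1 1] by auto
  have f1: "B $$ (0, 0) + 2 * B $$ (0, 1) * t + B $$ (1, 1) * t^2 = A $$ (0, 0)"
    using arg_cong[OF e1, of "\<lambda>x. b * x"] b0 by (simp add: distrib_left)
  have f2: "B $$ (0, 0) * \<tau> + B $$ (0, 1) * w + B $$ (0, 1) * t * \<tau> + B $$ (1, 1) * t * w = A $$ (0, 1)"
    using arg_cong[OF e2, of "\<lambda>x. b * x"] b0 by (simp add: distrib_left b_def mult.assoc)
  have f3: "B $$ (0, 0) * \<tau>^2 + 2 * B $$ (0, 1) * \<tau> * w + B $$ (1, 1) * w^2 = A $$ (1, 1)"
    using arg_cong[OF e3, of "\<lambda>x. b * x"] b0 by (simp add: distrib_left)
  define h where "h = w - \<tau> * t"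
  have h: "h \<noteq> 0" "v h = 0" using s by (auto simp: h_def)
  define X where "X = mat 2 2 (\<lambda>(i, j). if i = 0 then (if j = 0 then 1 else \<tau>) else (if j = 0 then t else w))"
  define Y where "Y = mat 2 2 (\<lambda>(i, j). if i = 0 then (if j = 0 then w / h else - \<tau> / h) else (if j = 0 then - t / h else 1 / h))"
  have c: "X \<in> carrier_mat 2 2" "Y \<in> carrier_mat 2 2" by (auto simp: X_def Y_def)
  have Xe: "X $$ (0, 0) = 1" "X $$ (0, 1) = \<tau>" "X $$ (1, 0) = t" "X $$ (1, 1) = w" by (auto simp: X_def)
  have Ye: "Y $$ (0, 0) = w / h" "Y $$ (0, 1) = - \<tau> / h" "Y $$ (1, 0) = - t / h" "Y $$ (1, 1) = 1 / h" by (auto simp: Y_def)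
  have hh: "w / h - \<tau> * t / h = 1" using h(1) by (simp add: h_def diff_divide_distrib[symmetric])
  have "X * Y = 1\<^sub>m 2"
  proof (rule eq_mat_2_2)
    show "(X * Y) $$ (0, 0) = 1\<^sub>m 2 $$ (0, 0)" "(X * Y) $$ (1, 1) = 1\<^sub>m 2 $$ (1, 1)"
      using hh Xe Ye by (simp_all add: mult_mat_2_2[OF c] mult.commute[of t] del: index_mult_mat)
    show "(X * Y) $$ (0, 1) = 1\<^sub>m 2 $$ (0, 1)" "(X * Y) $$ (1, 0) = 1\<^sub>m 2 $$ (1, 0)"
      using Xe Ye by (simp_all add: mult_mat_2_2[OF c] mult.commute[of t] del: index_mult_mat)
  qed (use c in auto)
  moreover have "Y * X = 1\<^sub>m 2"
  proof (rule eq_mat_2_2)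
    show "(Y * X) $$ (0, 0) = 1\<^sub>m 2 $$ (0, 0)" "(Y * X) $$ (1, 1) = 1\<^sub>m 2 $$ (1, 1)"
      using hh Xe Ye by (simp_all add: mult_mat_2_2[OF c(2,1)] mult.commute[of t] del: index_mult_mat)
    show "(Y * X) $$ (0, 1) = 1\<^sub>m 2 $$ (0, 1)" "(Y * X) $$ (1, 0) = 1\<^sub>m 2 $$ (1, 0)"
      using Xe Ye by (simp_all add: mult_mat_2_2[OF c(2,1)] mult.commute[of w] del: index_mult_mat)
  qed (use c in auto)
  moreover have "mge 0 X" "mge 0 Y"
    using s h by (auto simp: mge_def X_def Y_def intro!: vge_divide_unit)
  ultimately have "integral_inverses 2 X Y" using c by (auto simp: integral_inverses_def)
  moreover have "A = X\<^sup>T * B * X"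
  proof (rule eq_mat_2_2)
    have XB: "(X\<^sup>T * B * X) $$ (i, j) = (X $$ (0, i) * B $$ (0, 0) + X $$ (1, i) * B $$ (0, 1)) * X $$ (0, j)
       + (X $$ (0, i) * B $$ (0, 1) + X $$ (1, i) * B $$ (1, 1)) * X $$ (1, j)" if "i < 2" "j < 2" for i j
    proof -
      have "(X\<^sup>T * B * X) $$ (i, j) = (X\<^sup>T * B) $$ (i, 0) * X $$ (0, j) + (X\<^sup>T * B) $$ (i, 1) * X $$ (1, j)"
        using that c B by (intro mult_mat_2_2) auto
      then show ?thesis using that c B symB by (simp add: mult_mat_2_2 del: assoc_mult_mat index_mult_mat)
    qed
    show "A $$ (0, 0) = (X\<^sup>T * B * X) $$ (0, 0)"
      using f1 by (simp add: XB Xe algebra_simps power2_eq_square del: assoc_mult_mat index_mult_mat One_nat_def)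
    show "A $$ (0, 1) = (X\<^sup>T * B * X) $$ (0, 1)"
      using f2 by (simp add: XB Xe algebra_simps power2_eq_square del: assoc_mult_mat index_mult_mat One_nat_def)
    show "A $$ (1, 0) = (X\<^sup>T * B * X) $$ (1, 0)"
      using f2 symA by (simp add: XB Xe algebra_simps power2_eq_square del: assoc_mult_mat index_mult_mat One_nat_def)
    show "A $$ (1, 1) = (X\<^sup>T * B * X) $$ (1, 1)"
      using f3 by (simp add: XB Xe algebra_simps power2_eq_square del: assoc_mult_mat index_mult_mat One_nat_def)
  qed (use A B c in auto)
  ultimately show ?thesis unfolding congruent_def by blast
qed

text \<open>
  The determinant is \<open>- b\<^sup>2\<close> times a unit, because both diagonal entries have larger value than the
  off-diagonal entry \<open>b\<close>.
\<close>

lemma plane_inverse: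
  assumes A: "A \<in> carrier_mat 2 2" "A\<^sup>T = A"
    and b: "A $$ (0, 1) \<noteq> 0" and diag: "vgt (v (A $$ (0, 1))) (A $$ (0, 0))" "vgt (v (A $$ (0, 1))) (A $$ (1, 1))"
  shows "\<exists>W \<in> carrier_mat 2 2. A * W = 1\<^sub>m 2 \<and> mge (- v (A $$ (0, 1))) W"
proof -
  define a where "a = A $$ (0, 0)"
  define b where "b = A $$ (0, 1)"
  define c where "c = A $$ (1, 1)"
  have b0: "b \<noteq> 0" using b by (simp add: b_def)
  have symA: "A $$ (1, 0) = b"
    using A index_transpose_mat(1)[of 0 A 1] by (auto simp: b_def)
  define d where "d = a * c - b * b"
  have ac: "vgt (v b + v b) (a * c)"
    using vgt_mult_left[OF diag(1) vgt_imp_vge[OF diag(2)]] by (simp add: a_def b_def c_def)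
  have "vgt 0 (- (a * c / (b * b)))"
    using vgt_divide[OF ac, of "b * b"] b0 v_mult[OF b0 b0] by simp
  note u = unit_one_plus[OF this]
  have d_eq: "d = - (b * b * (1 + - (a * c / (b * b))))"
    using b0 by (simp add: d_def right_diff_distrib)
  have d0: "d \<noteq> 0" unfolding d_eq using u(1) b0 by simp
  have "v d = v b + v b" unfolding d_eq val_minus using u b0 by (subst v_mult) (auto simp: v_mult)
  then have q: "vge (- v b) (x / d)" if "vge (v b) x" for x
    using vge_divide[OF that d0] by simp
  define W where "W = mat 2 2 (\<lambda>(i, j). if i = 0 then (if j = 0 then c / d else - b / d) else (if j = 0 then - b / d else a / d))"
  have Wc: "W \<in> carrier_mat 2 2" by (simp add: W_def)
  have We: "W $$ (0, 0) = c / d" "W $$ (0, 1) = - b / d" "W $$ (1, 0) = - b / d" "W $$ (1, 1) = a / d" by (auto simp: W_def)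
  have dd: "a * c / d - b * b / d = 1" using d0 by (simp add: d_def diff_divide_distrib[symmetric])
  have "A * W = 1\<^sub>m 2"
    by (rule eq_mat_2_2)
      (use A Wc We dd symA a_def b_def c_def in \<open>auto simp: mult_mat_2_2 algebra_simps simp del: index_mult_mat\<close>)
  moreover have "vge (v b) a" "vge (v b) b" "vge (v b) c" 
    using diag by (auto simp: a_def b_def c_def vgt_def vge_def)
  then have "mge (- v b) W" using q[of "- b"] q[of b] q[of a] q[of c] by (auto simp: mge_def W_def)
  ultimately show ?thesis using Wc by (auto simp: b_def)
qed

text \<open>
  Induction on the size.  A pivot entry of minimal value \<open>\<beta>\<close> is moved to the front by a simultaneous
  permutation.  Since \<open>s\<close> is an entry of \<open>C A\<close> with \<open>C\<close> integral, \<open>\<beta> \<le> v s\<close>; therefore the bound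
  \<open>v s + 2 v 2\<close> is strong enough to compare the pivot blocks.
\<close>

theorem close_forms_congruent:
  assumes s: "s \<noteq> 0" and close: "close_forms n s (v s + (v 2 + v 2)) A B"
  shows "congruent n A B"
  using close
proof (induction n arbitrary: A B rule: less_induct)
  case (less n)
  let ?\<gamma> = "v s + (v 2 + v 2)"
  have A: "A \<in> carrier_mat n n" "A\<^sup>T = A" and B: "B \<in> carrier_mat n n"
    using less.prems by (auto simp: close_forms_def)
  obtain C where C: "C \<in> carrier_mat n n" "mge 0 C" "C * A = s \<cdot>\<^sub>m 1\<^sub>m n"
    using less.prems by (auto simp: close_forms_def)
  have sym: "A $$ (i, j) = A $$ (j, i)" if "i < n" "j < n" for i j
    using index_transpose_mat(1)[of j A i] A that by auto
  show ?case
  proof (cases "n = 0")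
    case True
    then have "A = 1\<^sub>m 0" "B = 1\<^sub>m 0" using A B by (auto intro!: eq_matI)
    then show ?thesis unfolding congruent_def using True
      by (intro exI[of _ "1\<^sub>m 0"]) (auto simp: integral_inverses_def)
  next
    case False
    then have n: "0 < n" by simp
    define S where "S = {(i, j). i < n \<and> j < n \<and> A $$ (i, j) \<noteq> 0}"
    have "finite S" by (rule finite_subset[of _ "{..<n} \<times> {..<n}"]) (auto simp: S_def)
    have "S \<noteq> {}"
    proof
      assume "S = {}"
      then have "A = 0\<^sub>m n n" using A by (intro eq_matI) (auto simp: S_def)
      then have "(s \<cdot>\<^sub>m 1\<^sub>m n) $$ (0, 0) = (0\<^sub>m n n :: 'k mat) $$ (0, 0)" using C by simp
      then show False using n s by simp
    qed
    define \<beta> where "\<beta> = Min ((\<lambda>(i, j). v (A $$ (i, j))) ` S)"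
    have \<beta>_in: "\<beta> \<in> (\<lambda>(i, j). v (A $$ (i, j))) ` S"
      unfolding \<beta>_def using \<open>finite S\<close> \<open>S \<noteq> {}\<close> by (intro Min_in) auto
    have \<beta>_le: "\<beta> \<le> v (A $$ (i, j))" if "i < n" "j < n" "A $$ (i, j) \<noteq> 0" for i j
      unfolding \<beta>_def using \<open>finite S\<close> that by (intro Min_le) (auto simp: S_def intro!: image_eqI[of _ _ "(i, j)"])
    have A\<beta>: "mge \<beta> A" using \<beta>_le A by (auto simp: mge_def vge_def)
    have "mge (0 + \<beta>) (C * A)" using A C A\<beta> by (intro mge_mult[of _ n n _ n]) auto
    from this[unfolded C(3) mge_def, rule_format, of 0 0]
    have \<beta>s: "\<beta> \<le> v s" using n s by (simp add: vge_def)
    have \<beta>\<gamma>: "\<beta> + (v 2 + v 2) \<le> ?\<gamma>" using \<beta>s by (simp add: add_right_mono)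
    have \<beta>\<gamma>': "\<beta> \<le> ?\<gamma>" using \<beta>\<gamma> val_two_nonneg add_increasing2[of "v 2 + v 2" \<beta> \<beta>] by (meson add_nonneg_nonneg order_refl order_trans)
    \<comment> \<open>The two kinds of pivot blocks differ in the permutation \<open>\<pi>\<close>, in the inverse \<open>W\<close> of the block, and
      in the reason why nearby blocks are congruent.\<close>
    have key: ?thesis
      if pi: "\<pi> permutes {..<n}" and p: "0 < p" "p \<le> n"
        and A1: "A1 = mat p p (\<lambda>(i, j). A $$ (\<pi> i, \<pi> j))"
        and W: "W \<in> carrier_mat p p" "A1 * W = 1\<^sub>m p" "mge (- \<beta>) W"
        and loc: "\<And>B1. B1 \<in> carrier_mat p p \<Longrightarrow> B1\<^sup>T = B1 \<Longrightarrow> mgt (\<beta> + (v 2 + v 2)) (B1 - A1) \<Longrightarrow> congruent p A1 B1"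
      for \<pi> p A1 W
    proof -
      obtain X Y where X: "integral_inverses n X Y" and 
        E: "\<And>A. A \<in> carrier_mat n n \<Longrightarrow> X\<^sup>T * A * X = mat n n (\<lambda>(i, j). A $$ (\<pi> i, \<pi> j))"
        using simultaneous_permutation[OF pi] by blast
      have lt: "\<pi> i < n" if "i < n" for i using permutes_in_image[OF pi, of i] that by simp
      let ?A = "X\<^sup>T * A * X"
      have A1': "mat p p (\<lambda>(i, j). ?A $$ (i, j)) = A1"
        unfolding E[OF A(1)] A1 using p by (intro eq_matI) auto
      have pq: "p + (n - p) = n" using p by simp
      have "congruent n (X\<^sup>T * A * X) (X\<^sup>T * B * X)"
      proof (rule pivot_step[of p "n - p" s ?\<gamma> ?A "X\<^sup>T * B * X" W \<beta>, unfolded A1' pq])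
        show "close_forms n s ?\<gamma> (X\<^sup>T * A * X) (X\<^sup>T * B * X)"
          by (rule close_forms_transport[OF X less.prems])
        show "mge \<beta> (X\<^sup>T * A * X)" unfolding E[OF A(1)] using A\<beta> A(1) lt by (auto simp: mge_def)
        show "congruent p A1 B1" if "B1 \<in> carrier_mat p p" "B1\<^sup>T = B1" "mgt ?\<gamma> (B1 - A1)" for B1
          using loc that mgt_mono \<beta>\<gamma> by blast
        show "congruent (n - p) D B" if "close_forms (n - p) s ?\<gamma> D B" for D B
          using less.IH[OF _ that] p n by simp
      qed (use W \<beta>\<gamma>' in auto)
      then show ?thesis using congruent_transport[OF X A(1) B] by simp
    qed
    show ?thesis
    proof (cases "\<exists>i < n. A $$ (i, i) \<noteq> 0 \<and> v (A $$ (i, i)) = \<beta>")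
      case True
      then obtain i where i: "i < n" "A $$ (i, i) \<noteq> 0" "v (A $$ (i, i)) = \<beta>" by blast
      let ?\<pi> = "Transposition.transpose 0 i"
      let ?A1 = "mat 1 1 (\<lambda>(k, l). A $$ (?\<pi> k, ?\<pi> l))"
      let ?W = "mat 1 1 (\<lambda>_. inverse (A $$ (i, i)))"
      show ?thesis
      proof (rule key[of ?\<pi> 1 ?A1 ?W])
        show "?\<pi> permutes {..<n}" using i n by (intro permutes_swap_id) auto
        show "?A1 * ?W = 1\<^sub>m 1" using i by (intro eq_matI) (auto simp: scalar_prod_def)
        show "mge (- \<beta>) ?W" using i val_inverse by (auto simp: mge_def vge_def)
        show "congruent 1 ?A1 B1" if "B1 \<in> carrier_mat 1 1" "mgt (\<beta> + (v 2 + v 2)) (B1 - ?A1)" for B1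
          using congruent_rank_one[of ?A1 B1] that i by simp
      qed (use n in auto)
    next
      case False
      obtain i j where ij: "i < n" "j < n" "A $$ (i, j) \<noteq> 0" "v (A $$ (i, j)) = \<beta>"
        using \<beta>_in by (auto simp: S_def)
      have neq: "i \<noteq> j" using False ij by auto
      have diag: "vgt \<beta> (A $$ (k, k))" if "k < n" for k
        using False \<beta>_le[of k k] that by (auto simp: vgt_def order_less_le)
      define l where "l = Transposition.transpose 0 i j"
      \<comment> \<open>The position of \<open>j\<close> after the exchange of \<open>0\<close> and \<open>i\<close> is \<open>l\<close>, so that \<open>\<pi>\<close> sends \<open>0\<close> to \<open>i\<close> and \<open>1\<close> to \<open>j\<close>.\<close>
      define \<pi> where "\<pi> = Transposition.transpose 0 i \<circ> Transposition.transpose 1 l"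
      have n2: "2 \<le> n" using ij neq by auto
      have l: "l < n" using ij n by (auto simp: l_def Transposition.transpose_def)
      have l0: "l \<noteq> 0" using neq by (auto simp: l_def Transposition.transpose_def)
      have p0: "\<pi> 0 = i" using l0 by (simp add: \<pi>_def transpose_apply_other)
      have p1: "\<pi> 1 = j" by (simp add: \<pi>_def l_def)
      have per: "\<pi> permutes {..<n}" unfolding \<pi>_def
        using n2 n ij l by (intro permutes_compose permutes_swap_id) auto
      let ?A1 = "mat 2 2 (\<lambda>(k, l). A $$ (\<pi> k, \<pi> l))"
      have e: "?A1 $$ (0, 0) = A $$ (i, i)" "?A1 $$ (0, 1) = A $$ (i, j)" "?A1 $$ (1, 1) = A $$ (j, j)"
        using p0 p1 by auto
      have lt: "\<pi> k < n" if "k < n" for k using permutes_in_image[OF per, of k] that by simp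
      have s1: "?A1\<^sup>T = ?A1" using n2 by (intro eq_matI) (auto intro!: sym lt)
      have d1: "vgt (v (?A1 $$ (0, 1))) (?A1 $$ (0, 0))" "vgt (v (?A1 $$ (0, 1))) (?A1 $$ (1, 1))" "?A1 $$ (0, 1) \<noteq> 0"
        unfolding e using diag ij by auto
      have "v (?A1 $$ (0, 1)) = \<beta>" unfolding e using ij by simp
      note pl = plane_inverse[of ?A1, unfolded this] congruent_rank_two[of ?A1, unfolded this]
      obtain W where W: "W \<in> carrier_mat 2 2" "?A1 * W = 1\<^sub>m 2" "mge (- \<beta>) W"
        using pl(1) s1 d1 \<open>v (?A1 $$ (0, 1)) = \<beta>\<close> by auto
      show ?thesis
      proof (rule key[OF per _ n2 refl W])
        show "congruent 2 ?A1 B1" if "B1 \<in> carrier_mat 2 2" "B1\<^sup>T = B1" "mgt (\<beta> + (v 2 + v 2)) (B1 - ?A1)" for B1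
          using pl(2) s1 d1 that \<open>v (?A1 $$ (0, 1)) = \<beta>\<close> by auto
      qed simp
    qed
  qed
qed

end

section \<open>Free modules over the valuation ring\<close>

context valuation
begin

lemma carrier_valring: "x \<in> carrier (valring v) \<longleftrightarrow> vge 0 x"
  by (simp add: valring_def vge_def)

lemma valring_simps [simp]:
  "x \<otimes>\<^bsub>valring v\<^esub> y = x * y" "x \<oplus>\<^bsub>valring v\<^esub> y = x + y" "\<zero>\<^bsub>valring v\<^esub> = 0" "\<one>\<^bsub>valring v\<^esub> = 1"
  by (simp_all add: valring_def)

lemma mem_val_ideal: "x \<in> val_ideal v \<gamma> \<longleftrightarrow> vgt \<gamma> x"
  by (auto simp: val_ideal_def vgt_def)

end

locale valuation_module = valuation v + Module.module "valring v" M
  for v :: "'k::field \<Rightarrow> 'g::linordered_ab_group_add" and M :: "('k, 'm) module" (structure)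
begin

text \<open>
  The module axioms, with scalars described by \<open>vge 0\<close> and with the operations of the field instead of
  those of \<open>valring v\<close>.
\<close>

lemma smult_in: "vge 0 a \<Longrightarrow> x \<in> carrier M \<Longrightarrow> a \<odot> x \<in> carrier M"
  by (simp add: carrier_valring)

lemma smult_add_left: "vge 0 a \<Longrightarrow> vge 0 b \<Longrightarrow> x \<in> carrier M \<Longrightarrow> (a + b) \<odot> x = a \<odot> x \<oplus> b \<odot> x"
  using smult_l_distr[of a b x] by (simp add: carrier_valring)

lemma smult_add_right: "vge 0 a \<Longrightarrow> x \<in> carrier M \<Longrightarrow> y \<in> carrier M \<Longrightarrow> a \<odot> (x \<oplus> y) = a \<odot> x \<oplus> a \<odot> y"
  using smult_r_distr[of a x y] by (simp add: carrier_valring)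

lemma smult_smult: "vge 0 a \<Longrightarrow> vge 0 b \<Longrightarrow> x \<in> carrier M \<Longrightarrow> a \<odot> (b \<odot> x) = (a * b) \<odot> x"
  using smult_assoc1[of a b x] by (simp add: carrier_valring)

lemma smult_one_left: "x \<in> carrier M \<Longrightarrow> 1 \<odot> x = x"
  using smult_one[of x] by simp

lemma smult_zero_left: "x \<in> carrier M \<Longrightarrow> 0 \<odot> x = \<zero>"
  using smult_l_null[of x] by simp

lemma smult_zero_right: "vge 0 a \<Longrightarrow> a \<odot> \<zero> = \<zero>"
  using smult_r_null[of a] by (simp add: carrier_valring)

lemma smult_minus_left: 
  assumes "vge 0 a" "x \<in> carrier M" shows "(- a) \<odot> x = \<ominus> (a \<odot> x)"
proof -
  have "(- a) \<odot> x \<oplus> a \<odot> x = (- a + a) \<odot> x"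
    using smult_add_left[of "- a" a x] assms by simp
  then have "(- a) \<odot> x \<oplus> a \<odot> x = \<zero>" using assms smult_zero_left by simp
  then show ?thesis using assms smult_in[of a x] smult_in[of "- a" x] M.minus_equality by auto
qed

definition lin :: "(nat \<Rightarrow> 'm) \<Rightarrow> nat \<Rightarrow> (nat \<Rightarrow> 'k) \<Rightarrow> 'm" where
  "lin b n c = (\<Oplus>i \<in> {..<n}. c i \<odot> b i)"

lemma lin_0 [simp]: "lin b 0 c = \<zero>"
  by (simp add: lin_def)

lemma lin_Suc:
  assumes "\<And>i. i < Suc n \<Longrightarrow> b i \<in> carrier M" "\<And>i. i < Suc n \<Longrightarrow> vge 0 (c i)"
  shows "lin b (Suc n) c = c n \<odot> b n \<oplus> lin b n c"
  unfolding lin_def lessThan_Suc using assms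
  by (subst M.finsum_insert) (auto intro!: smult_in)

lemma lin_closed:
  assumes "\<And>i. i < n \<Longrightarrow> b i \<in> carrier M" "\<And>i. i < n \<Longrightarrow> vge 0 (c i)"
  shows "lin b n c \<in> carrier M"
  unfolding lin_def using assms by (intro M.finsum_closed) (auto intro: smult_in)

lemma lin_cong:
  assumes "\<And>i. i < n \<Longrightarrow> b i \<in> carrier M" "\<And>i. i < n \<Longrightarrow> vge 0 (c i)" "\<And>i. i < n \<Longrightarrow> c i = d i"
  shows "lin b n c = lin b n d"
  unfolding lin_def using assms by (intro M.finsum_cong') (auto intro: smult_in)

lemma lin_add:
  assumes "\<And>i. i < n \<Longrightarrow> b i \<in> carrier M" "\<And>i. i < n \<Longrightarrow> vge 0 (c i)" "\<And>i. i < n \<Longrightarrow> vge 0 (d i)"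
  shows "lin b n (\<lambda>i. c i + d i) = lin b n c \<oplus> lin b n d"
proof -
  have "lin b n (\<lambda>i. c i + d i) = (\<Oplus>i \<in> {..<n}. c i \<odot> b i \<oplus> d i \<odot> b i)"
    unfolding lin_def using assms by (intro M.finsum_cong') (auto intro!: M.a_closed smult_in simp: smult_add_left)
  also have "\<dots> = lin b n c \<oplus> lin b n d"
    unfolding lin_def using assms by (intro M.finsum_addf) (auto intro: smult_in)
  finally show ?thesis .
qed

lemma lin_smult:
  assumes "vge 0 a" "\<And>i. i < n \<Longrightarrow> b i \<in> carrier M" "\<And>i. i < n \<Longrightarrow> vge 0 (c i)"
  shows "lin b n (\<lambda>i. a * c i) = a \<odot> lin b n c"
proof -
  have "lin b n (\<lambda>i. a * c i) = (\<Oplus>i \<in> {..<n}. a \<odot> (c i \<odot> b i))"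
    unfolding lin_def using assms by (intro M.finsum_cong') (auto intro: smult_in simp: smult_smult)
  also have "\<dots> = a \<odot> lin b n c"
    unfolding lin_def using assms
    by (intro finsum_smult_ldistr[symmetric]) (auto intro: smult_in simp: carrier_valring)
  finally show ?thesis .
qed

lemma lin_lin:
  assumes "\<And>i. i < r \<Longrightarrow> b i \<in> carrier M" "\<And>i j. i < r \<Longrightarrow> j < n \<Longrightarrow> vge 0 (X i j)" "\<And>j. j < n \<Longrightarrow> vge 0 (c j)"
  shows "lin (\<lambda>j. lin b r (\<lambda>i. X i j)) n c = lin b r (\<lambda>i. \<Sum>j<n. X i j * c j)"
  using assms(2,3)
proof (induction n)
  case 0
  show ?case using lin_smult[of 0 r b "\<lambda>_. 0"] assms(1) by (simp add: smult_zero_left lin_closed)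
next
  case (Suc n)
  have "lin (\<lambda>j. lin b r (\<lambda>i. X i j)) (Suc n) c = 
      c n \<odot> lin b r (\<lambda>i. X i n) \<oplus> lin (\<lambda>j. lin b r (\<lambda>i. X i j)) n c"
    using assms(1) Suc.prems by (intro lin_Suc lin_closed) auto
  also have "c n \<odot> lin b r (\<lambda>i. X i n) = lin b r (\<lambda>i. c n * X i n)"
    using assms(1) Suc.prems by (intro lin_smult[symmetric]) auto
  also have "lin (\<lambda>j. lin b r (\<lambda>i. X i j)) n c = lin b r (\<lambda>i. \<Sum>j<n. X i j * c j)"
    using Suc by auto
  also have "lin b r (\<lambda>i. c n * X i n) \<oplus> lin b r (\<lambda>i. \<Sum>j<n. X i j * c j)
     = lin b r (\<lambda>i. c n * X i n + (\<Sum>j<n. X i j * c j))"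
    using assms(1) Suc.prems by (intro lin_add[symmetric] vge_sum vge_0_mult) auto
  finally show ?case by (simp add: algebra_simps)
qed

lemma lin_unit:
  assumes "i < n" "\<And>i. i < n \<Longrightarrow> b i \<in> carrier M"
  shows "lin b n (\<lambda>j. if j = i then 1 else 0) = b i"
proof -
  have "(\<Oplus>j \<in> {..<n}. (if j = i then 1 else 0) \<odot> b j) = (\<Oplus>j \<in> {..<n}. if i = j then b j else \<zero>)"
    using assms by (intro M.finsum_cong') (auto simp: smult_one_left smult_zero_left)
  also have "\<dots> = b i" using assms by (intro M.add.finprod_singleton) auto
  finally show ?thesis by (simp add: lin_def)
qed

text \<open>
  Bases are families indexed by initial segments of \<open>nat\<close>, as required for Gram matrices.
\<close>

definition basis :: "(nat \<Rightarrow> 'm) \<Rightarrow> nat \<Rightarrow> bool" where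
  "basis b n \<longleftrightarrow> (\<forall>i < n. b i \<in> carrier M) \<and>
     (\<forall>x \<in> carrier M. \<exists>c. (\<forall>i < n. vge 0 (c i)) \<and> x = lin b n c) \<and>
     (\<forall>c d. (\<forall>i < n. vge 0 (c i)) \<longrightarrow> (\<forall>i < n. vge 0 (d i)) \<longrightarrow> lin b n c = lin b n d \<longrightarrow> (\<forall>i < n. c i = d i))"

lemma basis_exists:
  assumes "free_finite_rank (valring v) M"
  shows "\<exists>b n. basis b n"
proof -
  from assms obtain B where *: "finite B \<and> B \<subseteq> carrier M \<and> (\<forall>x \<in> carrier M.
      \<exists>!c. c \<in> B \<rightarrow>\<^sub>E carrier (valring v) \<and> x = (\<Oplus>b \<in> B. c b \<odot> b))"
    unfolding free_finite_rank_def by (elim exE)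
  then have B: "finite B" "B \<subseteq> carrier M" by simp_all
  have u: "\<exists>!c. c \<in> B \<rightarrow>\<^sub>E carrier (valring v) \<and> x = (\<Oplus>b \<in> B. c b \<odot> b)" if "x \<in> carrier M" for x
    using * that by simp
  have u': "C = D"
    if "C \<in> B \<rightarrow>\<^sub>E carrier (valring v) \<and> x = (\<Oplus>b \<in> B. C b \<odot> b)"
      "D \<in> B \<rightarrow>\<^sub>E carrier (valring v) \<and> x = (\<Oplus>b \<in> B. D b \<odot> b)" "x \<in> carrier M" for C D x
  proof -
    from u[OF that(3)] obtain c where "\<And>e. e \<in> B \<rightarrow>\<^sub>E carrier (valring v) \<and> x = (\<Oplus>b \<in> B. e b \<odot> b) \<Longrightarrow> e = c"
      by (elim ex1E) blast
    from this[OF that(1)] this[OF that(2)] show ?thesis by simp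
  qed
  obtain h where h: "bij_betw h {..<card B} B"
    using ex_bij_betw_nat_finite[OF B(1)] by (auto simp: atLeast0LessThan)
  let ?n = "card B"
  have hB: "h i \<in> B" if "i < ?n" for i using h that by (auto simp: bij_betw_def)
  have hc: "h i \<in> carrier M" if "i < ?n" for i using hB[OF that] B by auto
  have L: "(\<Oplus>b \<in> B. e b \<odot> b) = lin h ?n (\<lambda>i. e (h i))" if "\<And>b. b \<in> B \<Longrightarrow> vge 0 (e b)" for e
    unfolding lin_def using h hc hB that subsetD[OF B(2)]
    by (subst bij_betw_imp_surj_on[OF h, symmetric], subst M.finsum_reindex)
      (auto simp: bij_betw_def intro!: smult_in)
  have "basis h ?n" unfolding basis_def
  proof (intro conjI allI impI ballI)
    fix x assume x: "x \<in> carrier M"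
    obtain e where e: "e \<in> B \<rightarrow>\<^sub>E carrier (valring v)" "x = (\<Oplus>b \<in> B. e b \<odot> b)"
      using ex1_implies_ex[OF u[OF x]] by auto
    have e': "vge 0 (e b)" if "b \<in> B" for b using e that by (auto simp: carrier_valring[symmetric])
    show "\<exists>c. (\<forall>i < ?n. vge 0 (c i)) \<and> x = lin h ?n c"
      using e e' L hB by (intro exI[of _ "\<lambda>i. e (h i)"]) auto
  next
    fix c d i assume c: "\<forall>i < ?n. vge 0 (c i)" and d: "\<forall>i < ?n. vge 0 (d i)"
      and eq: "lin h ?n c = lin h ?n d" and i: "i < ?n"
    define g where "g = the_inv_into {..<?n} h"
    have gh: "g (h i) = i" if "i < ?n" for i
      unfolding g_def using h that by (intro the_inv_into_f_f) (auto simp: bij_betw_def)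
    have g: "g b < ?n" if "b \<in> B" for b
      using the_inv_into_into[of h "{..<?n}" b "{..<?n}"] h that by (auto simp: bij_betw_def g_def)
    have rep: "(\<lambda>b\<in>B. c (g b)) \<in> B \<rightarrow>\<^sub>E carrier (valring v) \<and> lin h ?n c = (\<Oplus>b \<in> B. (\<lambda>b\<in>B. c (g b)) b \<odot> b)"
      if c: "\<forall>i < ?n. vge 0 (c i)" for c
    proof
      have "(\<Oplus>b \<in> B. (\<lambda>b\<in>B. c (g b)) b \<odot> b) = lin h ?n (\<lambda>i. (\<lambda>b\<in>B. c (g b)) (h i))"
        using c g by (intro L) auto
      also have "\<dots> = lin h ?n c" using c hc gh hB by (intro lin_cong) auto
      finally show "lin h ?n c = (\<Oplus>b \<in> B. (\<lambda>b\<in>B. c (g b)) b \<odot> b)" by simp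
    qed (use c g in \<open>auto simp: carrier_valring\<close>)
    have "(\<lambda>b\<in>B. c (g b)) = (\<lambda>b\<in>B. d (g b))"
      by (rule u'[OF rep[OF c] rep[OF d, folded eq] lin_closed]) (use hc c in auto)
    from fun_cong[OF this, of "h i"] show "c i = d i" using gh[OF i] hB[OF i] by simp
  qed (use hc in auto)
  then show ?thesis by blast
qed

lemma additive_finsum:
  assumes add: "\<And>x y. x \<in> carrier M \<Longrightarrow> y \<in> carrier M \<Longrightarrow> (h (x \<oplus> y) :: 'k) = h x + h y"
    and "finite S" "\<And>s. s \<in> S \<Longrightarrow> g s \<in> carrier M"
  shows "h (\<Oplus>s \<in> S. g s) = (\<Sum>s \<in> S. h (g s))"
  using assms(2,3)
proof (induction S rule: finite_induct)
  case empty
  have "h \<zero> = h \<zero> + h \<zero>" using add[of \<zero> \<zero>] by simp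
  then have "h \<zero> = 0" by (metis add_cancel_right_right)
  then show ?case by simp
next
  case (insert s S)
  then have "(\<Oplus>s \<in> insert s S. g s) = g s \<oplus> (\<Oplus>s \<in> S. g s)"
    by (intro M.finsum_insert) auto
  then show ?case using insert add by (auto intro: M.finsum_closed)
qed

text \<open>
  Unlike the elements of \<open>dual_module\<close>, functionals are not required to be extensional, so that a
  functional on a module is also one on each of its submodules.
\<close>

definition functional :: "('m \<Rightarrow> 'k) \<Rightarrow> bool" where
  "functional f \<longleftrightarrow> (\<forall>x \<in> carrier M. vge 0 (f x)) \<and>
     (\<forall>x \<in> carrier M. \<forall>y \<in> carrier M. f (x \<oplus> y) = f x + f y) \<and>
     (\<forall>a x. vge 0 a \<longrightarrow> x \<in> carrier M \<longrightarrow> f (a \<odot> x) = a * f x)"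

lemma functional_finsum:
  assumes "functional f" "finite S" "\<And>s. s \<in> S \<Longrightarrow> g s \<in> carrier M"
  shows "f (\<Oplus>s \<in> S. g s) = (\<Sum>s \<in> S. f (g s))"
  using assms by (intro additive_finsum) (auto simp: functional_def)

lemma functional_lin:
  assumes "functional f" "\<And>i. i < n \<Longrightarrow> b i \<in> carrier M" "\<And>i. i < n \<Longrightarrow> vge 0 (c i)"
  shows "f (lin b n c) = (\<Sum>i<n. c i * f (b i))"
  unfolding lin_def using assms
  by (subst functional_finsum) (auto simp: functional_def intro: smult_in)

lemma coordinate_functionals:
  assumes "basis b n"
  obtains co where "\<And>x i. x \<in> carrier M \<Longrightarrow> i < n \<Longrightarrow> vge 0 (co x i)"
    and "\<And>x. x \<in> carrier M \<Longrightarrow> lin b n (co x) = x"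
    and "\<And>i. i < n \<Longrightarrow> functional (\<lambda>x. co x i)"
    and "\<And>c i. (\<And>i. i < n \<Longrightarrow> vge 0 (c i)) \<Longrightarrow> i < n \<Longrightarrow> co (lin b n c) i = c i"
proof -
  have b: "b i \<in> carrier M" if "i < n" for i using assms that by (auto simp: basis_def)
  have "\<forall>x \<in> carrier M. \<exists>c. (\<forall>i < n. vge 0 (c i)) \<and> lin b n c = x"
    using assms unfolding basis_def by metis
  then obtain co where co: "\<And>x i. x \<in> carrier M \<Longrightarrow> i < n \<Longrightarrow> vge 0 (co x i)"
    "\<And>x. x \<in> carrier M \<Longrightarrow> lin b n (co x) = x" by metis
  have u: "c i = d i" if "\<And>i. i < n \<Longrightarrow> vge 0 (c i)" "\<And>i. i < n \<Longrightarrow> vge 0 (d i)" 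
      "lin b n c = lin b n d" "i < n" for c d i
    using assms that unfolding basis_def by blast
  show ?thesis
  proof
    show e: "co (lin b n c) i = c i" if "\<And>i. i < n \<Longrightarrow> vge 0 (c i)" "i < n" for c i
      using that co b lin_closed by (intro u) auto
    show "functional (\<lambda>x. co x i)" if i: "i < n" for i
      unfolding functional_def
    proof (intro conjI ballI allI impI)
      fix x y assume x: "x \<in> carrier M" and y: "y \<in> carrier M"
      show "co (x \<oplus> y) i = co x i + co y i"
        using e[of "\<lambda>i. co x i + co y i" i] lin_add[of n b "co x" "co y"] b co x y i 
        by (simp add: vge_add)
    next
      fix a x assume a: "vge 0 a" and x: "x \<in> carrier M"
      show "co (a \<odot> x) i = a * co x i"
        using e[of "\<lambda>i. a * co x i" i] lin_smult[of a n b "co x"] b co x a i 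
        by (simp add: vge_0_mult)
    qed (use co i in auto)
  qed (use co in auto)
qed

end

section \<open>Reduction modulo an ideal and Nakayama's lemma\<close>

context valuation_module
begin

lemma form_functional:
  assumes sb: "symmetric_bilinear (valring v) M F" and y: "y \<in> carrier M"
  shows "functional (\<lambda>x. F x y)" "functional (F y)"
proof -
  show 1: "functional (\<lambda>x. F x y)"
    using sb y unfolding symmetric_bilinear_def functional_def by (auto simp: carrier_valring)
  have "F y x = F x y" if "x \<in> carrier M" for x
    using sb y that unfolding symmetric_bilinear_def by blast
  then show "functional (F y)" using 1 unfolding functional_def by (auto simp: smult_in)
qed

lemma form_sym:
  assumes sb: "symmetric_bilinear (valring v) M F" and "x \<in> carrier M" "y \<in> carrier M"
  shows "F x y = F y x"
  using assms unfolding symmetric_bilinear_def by blast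

abbreviation IM :: "'g \<Rightarrow> 'm set" where
  "IM \<gamma> \<equiv> ideal_smult (val_ideal v \<gamma>) M"

text \<open>
  The negative of a generator \<open>a \<odot> x\<close> is the generator \<open>(- a) \<odot> x\<close>, so the generated subgroup consists
  of the sums of generators.
\<close>

lemma IM_induct [consumes 2, case_names zero smult add]:
  assumes x: "x \<in> IM \<gamma>" and \<gamma>: "0 \<le> \<gamma>"
    and zero: "P \<zero>" and sm: "\<And>a x. vgt \<gamma> a \<Longrightarrow> x \<in> carrier M \<Longrightarrow> P (a \<odot> x)"
    and add: "\<And>x y. x \<in> carrier M \<Longrightarrow> y \<in> carrier M \<Longrightarrow> P x \<Longrightarrow> P y \<Longrightarrow> P (x \<oplus> y)"
  shows "P x"
proof -
  have "x \<in> carrier M \<and> P x"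
    using x unfolding ideal_smult_def
  proof (induction rule: generate.induct)
    case one
    show ?case using zero by simp
  next
    case (incl h)
    then show ?case using sm \<gamma> by (auto simp: mem_val_ideal intro!: smult_in vgt_imp_vge elim: vgt_mono)
  next
    case (inv h)
    then obtain a x where a: "vgt \<gamma> a" "x \<in> carrier M" "h = a \<odot> x" by (auto simp: mem_val_ideal)
    have a0: "vge 0 a" using a \<gamma> vgt_imp_vge vgt_mono by blast
    have "inv\<^bsub>add_monoid M\<^esub> h = \<ominus> h" by (simp add: a_inv_def)
    also have "\<dots> = (- a) \<odot> x" using smult_minus_left[OF a0 a(2)] a(3) by simp
    finally show ?case using sm[of "- a" x] a a0 smult_in[of "- a" x] by simp
  next
    case (eng h1 h2)
    then show ?case using add by simp
  qed
  then show ?thesis ..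
qed

lemma IM_carrier: "x \<in> IM \<gamma> \<Longrightarrow> 0 \<le> \<gamma> \<Longrightarrow> x \<in> carrier M"
  using IM_induct[of x \<gamma> "\<lambda>x. x \<in> carrier M"] smult_in vgt_imp_vge vgt_mono by auto

lemma IM_zero: "\<zero> \<in> IM \<gamma>"
  using generate.one[of "add_monoid M"] unfolding ideal_smult_def by simp

lemma IM_smultI: "vgt \<gamma> a \<Longrightarrow> x \<in> carrier M \<Longrightarrow> a \<odot> x \<in> IM \<gamma>"
  unfolding ideal_smult_def by (rule generate.incl) (auto simp: mem_val_ideal)

lemma IM_add: "x \<in> IM \<gamma> \<Longrightarrow> y \<in> IM \<gamma> \<Longrightarrow> x \<oplus> y \<in> IM \<gamma>"
  using generate.eng[of x "add_monoid M" _ y] unfolding ideal_smult_def by simp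

lemma IM_smult:
  assumes "x \<in> IM \<gamma>" "0 \<le> \<gamma>" "vge 0 c" shows "c \<odot> x \<in> IM \<gamma>"
proof -
  show ?thesis
    using assms(1,2)
  proof (induction rule: IM_induct)
    case zero
    show ?case using assms IM_zero by (simp add: smult_zero_right)
  next
    case (smult a x)
    have "vge 0 a" using smult(1) assms(2) vgt_imp_vge vgt_mono by blast
    then have "c \<odot> (a \<odot> x) = (c * a) \<odot> x" using smult_smult assms smult by simp
    moreover have "vgt \<gamma> (c * a)" using vgt_mult_right[OF assms(3) smult(1)] by simp
    ultimately show ?case using IM_smultI smult by simp
  next
    case (add x y)
    then show ?case using IM_add smult_add_right assms by simp
  qed
qed

lemma IM_minus: 
  assumes "x \<in> IM \<gamma>" "0 \<le> \<gamma>" shows "\<ominus> x \<in> IM \<gamma>"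
  using IM_smult[OF assms, of "-1"] smult_minus_left[of 1 x] IM_carrier[OF assms] smult_one_left
  by simp

lemma IM_abelian_subgroup: 
  assumes "0 \<le> \<gamma>" shows "abelian_subgroup (IM \<gamma>) M"
proof (rule abelian_subgroupI3)
  show "additive_subgroup (IM \<gamma>) M"
    by (rule additive_subgroup.intro, rule M.add.subgroupI)
      (use assms IM_carrier IM_zero[of \<gamma>] IM_add IM_minus in \<open>auto simp: a_inv_def[symmetric]\<close>)
qed (rule M.abelian_group_axioms)

lemma coset_absorb:
  assumes "0 \<le> \<gamma>" "e \<in> IM \<gamma>" "x \<in> carrier M" shows "IM \<gamma> +> (e \<oplus> x) = IM \<gamma> +> x"
proof -
  interpret abelian_subgroup "IM \<gamma>" M by (rule IM_abelian_subgroup[OF assms(1)])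
  have "e \<oplus> x \<in> IM \<gamma> +> x" unfolding a_r_coset_def' using assms by auto
  then show ?thesis using a_repr_independence' assms by metis
qed

lemma coset_memD: "y \<in> IM \<gamma> +> x \<Longrightarrow> \<exists>e \<in> IM \<gamma>. y = e \<oplus> x"
  unfolding a_r_coset_def' by auto

lemma coset_self: "x \<in> carrier M \<Longrightarrow> x \<in> IM \<gamma> +> x"
  unfolding a_r_coset_def' using IM_zero[of \<gamma>] by force

lemma coset_carrier: "carrier (quot_module (val_ideal v \<gamma>) M) = {IM \<gamma> +> x | x. x \<in> carrier M}"
  by (auto simp: quot_module_def A_RCOSETS_def')

lemma quot_add:
  assumes "0 \<le> \<gamma>" "x \<in> carrier M" "y \<in> carrier M"
  shows "(IM \<gamma> +> x) \<oplus>\<^bsub>quot_module (val_ideal v \<gamma>) M\<^esub> (IM \<gamma> +> y) = IM \<gamma> +> (x \<oplus> y)"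
proof -
  interpret abelian_subgroup "IM \<gamma>" M by (rule IM_abelian_subgroup[OF assms(1)])
  show ?thesis using a_rcos_sum assms by (simp add: quot_module_def)
qed

lemma quot_scalar: "vge 0 a \<Longrightarrow> val_ideal v \<gamma> +>\<^bsub>valring v\<^esub> a \<in> carrier (valring v Quot val_ideal v \<gamma>)"
  by (auto simp: FactRing_def A_RCOSETS_def' carrier_valring)

lemma scalar_coset_iff: "a' \<in> val_ideal v \<gamma> +>\<^bsub>valring v\<^esub> a \<longleftrightarrow> vgt \<gamma> (a' - a)"
proof
  assume "vgt \<gamma> (a' - a)"
  then show "a' \<in> val_ideal v \<gamma> +>\<^bsub>valring v\<^esub> a"
    unfolding a_r_coset_def' by (auto simp: mem_val_ideal intro!: bexI[of _ "a' - a"])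
qed (auto simp: a_r_coset_def' mem_val_ideal)

text \<open>
  The union in the definition runs over equal cosets: \<open>(h + a) (e + x)\<close> differs from \<open>a x\<close> by
  \<open>h (e + x) + a e\<close>, which is in \<open>I M\<close> for \<open>h \<in> I\<close> and \<open>e \<in> I M\<close>.
\<close>

lemma quot_smult:
  assumes \<gamma>: "0 \<le> \<gamma>" and a: "vge 0 a" and x: "x \<in> carrier M"
  shows "(val_ideal v \<gamma> +>\<^bsub>valring v\<^esub> a) \<odot>\<^bsub>quot_module (val_ideal v \<gamma>) M\<^esub> (IM \<gamma> +> x) = IM \<gamma> +> (a \<odot> x)"
proof -
  have *: "IM \<gamma> +> (a' \<odot> x') = IM \<gamma> +> (a \<odot> x)"
    if a': "a' \<in> val_ideal v \<gamma> +>\<^bsub>valring v\<^esub> a" and x': "x' \<in> IM \<gamma> +> x" for a' x'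
  proof -
    obtain e where e: "e \<in> IM \<gamma>" "x' = e \<oplus> x" using coset_memD[OF x'] by blast
    define h where "h = a' - a"
    have h: "vgt \<gamma> h" "a' = h + a" using a' by (auto simp: h_def scalar_coset_iff)
    have h0: "vge 0 h" using h \<gamma> vgt_imp_vge vgt_mono by blast
    have ec: "e \<in> carrier M" using e IM_carrier \<gamma> by blast
    have "a' \<odot> x' = h \<odot> x' \<oplus> (a \<odot> e \<oplus> a \<odot> x)"
      unfolding h(2) e(2) using h0 a ec x by (simp add: smult_add_left smult_add_right del: smult_closed)
    also have "\<dots> = (h \<odot> x' \<oplus> a \<odot> e) \<oplus> a \<odot> x"
      using h0 a ec x e(2) by (simp add: M.a_assoc smult_in)
    finally have "a' \<odot> x' = (h \<odot> x' \<oplus> a \<odot> e) \<oplus> a \<odot> x" .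
    moreover have "h \<odot> x' \<oplus> a \<odot> e \<in> IM \<gamma>"
      using ec x e(2) by (intro IM_add IM_smultI[OF h(1)] IM_smult[OF e(1) \<gamma> a]) simp
    ultimately show ?thesis using coset_absorb \<gamma> a x smult_in by simp
  qed
  have "a \<in> val_ideal v \<gamma> +>\<^bsub>valring v\<^esub> a" by (simp add: scalar_coset_iff)
  moreover have "x \<in> IM \<gamma> +> x" using coset_self x by blast
  ultimately have ne: "val_ideal v \<gamma> +>\<^bsub>valring v\<^esub> a \<noteq> {}" "IM \<gamma> +> x \<noteq> {}" by auto
  have "(val_ideal v \<gamma> +>\<^bsub>valring v\<^esub> a) \<odot>\<^bsub>quot_module (val_ideal v \<gamma>) M\<^esub> (IM \<gamma> +> x) =
     (\<Union>a' \<in> val_ideal v \<gamma> +>\<^bsub>valring v\<^esub> a. \<Union>x' \<in> IM \<gamma> +> x. IM \<gamma> +> (a' \<odot> x'))"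
    by (simp add: quot_module_def)
  also have "\<dots> = (\<Union>a' \<in> val_ideal v \<gamma> +>\<^bsub>valring v\<^esub> a. \<Union>x' \<in> IM \<gamma> +> x. IM \<gamma> +> (a \<odot> x))"
    by (intro SUP_cong refl *)
  also have "\<dots> = IM \<gamma> +> (a \<odot> x)" using ne by simp
  finally show ?thesis .
qed

lemma form_IM:
  assumes sb: "symmetric_bilinear (valring v) M F" and \<gamma>: "0 \<le> \<gamma>" and x: "x \<in> IM \<gamma>" and y: "y \<in> carrier M"
  shows "vgt \<gamma> (F x y)"
proof -
  note f = form_functional(1)[OF sb y, unfolded functional_def]
  show ?thesis
    using x \<gamma>
  proof (induction rule: IM_induct)
    case zero
    have "F (0 \<odot> \<zero>) y = 0 * F \<zero> y" using f by (metis vge_zero M.zero_closed)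
    then show ?case by (simp add: smult_zero_left)
  next
    case (smult a x)
    have "vge 0 a" using smult(1) \<gamma> vgt_imp_vge vgt_mono by blast
    then have "F (a \<odot> x) y = a * F x y" using f smult by blast
    then show ?case using vgt_mult_left[of \<gamma> a 0 "F x y"] f smult by simp
  next
    case (add x y)
    then show ?case using f vgt_add by simp
  qed
qed

lemma quot_form_iff:
  assumes sb: "symmetric_bilinear (valring v) M F" and \<gamma>: "0 \<le> \<gamma>" and x: "x \<in> carrier M" and y: "y \<in> carrier M"
  shows "z \<in> quot_form (valring v) (val_ideal v \<gamma>) F (IM \<gamma> +> x) (IM \<gamma> +> y) \<longleftrightarrow> vgt \<gamma> (z - F x y)"
proof
  assume "z \<in> quot_form (valring v) (val_ideal v \<gamma>) F (IM \<gamma> +> x) (IM \<gamma> +> y)"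
  then obtain x' y' where x': "x' \<in> IM \<gamma> +> x" and y': "y' \<in> IM \<gamma> +> y" and z: "vgt \<gamma> (z - F x' y')"
    unfolding quot_form_def scalar_coset_iff[symmetric] by blast
  obtain e where e: "e \<in> IM \<gamma>" "x' = e \<oplus> x" using coset_memD[OF x'] by blast
  obtain d where d: "d \<in> IM \<gamma>" "y' = d \<oplus> y" using coset_memD[OF y'] by blast
  have ed: "e \<in> carrier M" "d \<in> carrier M" "y' \<in> carrier M" using e d IM_carrier \<gamma> y by auto
  have "F x' y' = F e y' + F x y'"
    using form_functional(1)[OF sb ed(3)] e(2) ed x unfolding functional_def by blast
  also have "F x y' = F x d + F x y"
    using form_functional(2)[OF sb x] d(2) ed y unfolding functional_def by blast
  also have "F x d = F d x" using form_sym[OF sb] ed x by blast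
  finally have eq: "z - F x y = (z - F x' y') + (F e y' + F d x)" by simp
  have "vgt \<gamma> ((z - F x' y') + (F e y' + F d x))"
    by (intro vgt_add z form_IM[OF sb \<gamma>] e d ed x)
  then show "vgt \<gamma> (z - F x y)" unfolding eq .
next
  assume "vgt \<gamma> (z - F x y)"
  then show "z \<in> quot_form (valring v) (val_ideal v \<gamma>) F (IM \<gamma> +> x) (IM \<gamma> +> y)"
    unfolding quot_form_def scalar_coset_iff[symmetric] using coset_self[OF x] coset_self[OF y] by blast
qed

lemma IM_lin:
  assumes b: "basis b n" and \<gamma>: "0 \<le> \<gamma>" and x: "x \<in> IM \<gamma>"
  shows "\<exists>c. (\<forall>i < n. vgt \<gamma> (c i)) \<and> x = lin b n c"
proof -
  have bc: "b i \<in> carrier M" if "i < n" for i using b that by (auto simp: basis_def)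
  have g0: "vge 0 a" if "vgt \<gamma> a" for a using that \<gamma> vgt_imp_vge vgt_mono by blast
  show ?thesis
    using x \<gamma>
  proof (induction rule: IM_induct)
    case zero
    have "\<zero> = lin b n (\<lambda>_. 0 * 0)"
      using lin_smult[of 0 n b "\<lambda>_. 0"] bc by (simp add: smult_zero_left lin_closed)
    then show ?case by (intro exI[of _ "\<lambda>_. 0 * 0"]) auto
  next
    case (smult a x)
    obtain c where c: "\<forall>i < n. vge 0 (c i)" "x = lin b n c" using b smult unfolding basis_def by blast
    have "a \<odot> x = lin b n (\<lambda>i. a * c i)" unfolding c(2) using c(1) smult g0 bc by (intro lin_smult[symmetric]) auto
    moreover have "\<forall>i < n. vgt \<gamma> (a * c i)" using vgt_mult_left[OF smult(1)] c(1) by (metis add.right_neutral)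
    ultimately show ?case by (intro exI[of _ "\<lambda>i. a * c i"] conjI)
  next
    case (add x y)
    then obtain c d where c: "\<forall>i < n. vgt \<gamma> (c i)" "x = lin b n c" and d: "\<forall>i < n. vgt \<gamma> (d i)" "y = lin b n d"
      by blast
    have "x \<oplus> y = lin b n (\<lambda>i. c i + d i)" 
      unfolding c(2) d(2) using c(1) d(1) g0 bc by (intro lin_add[symmetric]) auto
    moreover have "\<forall>i < n. vgt \<gamma> (c i + d i)" using c(1) d(1) vgt_add by blast
    ultimately show ?case by (intro exI[of _ "\<lambda>i. c i + d i"] conjI)
  qed
qed

text \<open>
  The elements of the basis \<open>b\<close> of the module are removed from the generating system one by one.  If the
  elements \<open>w j\<close> together with small multiples of \<open>b 0, \<dots>, b q\<close> represent every element,
  they represent \<open>b q\<close>; the coefficient of \<open>b q\<close> in this representation is in the maximal ideal, so the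
  equation can be solved for \<open>b q\<close>.
\<close>

lemma nakayama:
  assumes b: "basis b r" and \<gamma>: "0 \<le> \<gamma>" and w: "\<And>j. j < n \<Longrightarrow> w j \<in> carrier M"
    and gen: "\<And>y. y \<in> carrier M \<Longrightarrow> \<exists>c. (\<forall>j < n. vge 0 (c j)) \<and> (\<exists>e \<in> IM \<gamma>. y = e \<oplus> lin w n c)"
    and y: "y \<in> carrier M"
  shows "\<exists>c. (\<forall>j < n. vge 0 (c j)) \<and> y = lin w n c"
proof -
  have bc: "b i \<in> carrier M" if "i < r" for i using b that by (auto simp: basis_def)
  have claim: "\<forall>y \<in> carrier M. \<exists>c d. (\<forall>j < n. vge 0 (c j)) \<and> (\<forall>i < q. vgt 0 (d i)) \<and> y = lin w n c \<oplus> lin b q d"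
    if "q \<le> r" for q
    using that
  proof (induction q rule: inc_induct)
    case base
    show ?case
    proof
      fix y assume "y \<in> carrier M"
      then obtain c e where c: "\<forall>j < n. vge 0 (c j)" and e: "e \<in> IM \<gamma>" "y = e \<oplus> lin w n c"
        using gen by blast
      obtain d where d: "\<forall>i < r. vgt \<gamma> (d i)" "e = lin b r d" using IM_lin[OF b \<gamma> e(1)] by blast
      have "e \<in> carrier M" "lin w n c \<in> carrier M" using IM_carrier e \<gamma> lin_closed c w by auto
      then have "y = lin w n c \<oplus> lin b r d" using e d M.a_comm by simp
      then show "\<exists>c d. (\<forall>j < n. vge 0 (c j)) \<and> (\<forall>i < r. vgt 0 (d i)) \<and> y = lin w n c \<oplus> lin b r d"
        using c d \<gamma> vgt_mono by blast
    qed
  next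
    case (step q)
    note IH = step.IH
    have q: "q < r" using step by simp
    have g0: "vge 0 a" if "vgt 0 a" for a using that vgt_imp_vge by blast
    have bq: "b q \<in> carrier M" using bc q by simp
    obtain c d where c: "\<forall>j < n. vge 0 (c j)" and d: "\<forall>i < Suc q. vgt 0 (d i)"
      and eq: "b q = lin w n c \<oplus> lin b (Suc q) d" using IH bq by blast
    define u where "u = 1 / (1 + - d q)"
    have "vgt 0 (- d q)" using d by simp
    note u1 = unit_one_plus[OF this]
    have u: "vge 0 u" unfolding u_def using u1 by (intro vge_divide_unit) auto
    have L: "lin w n c \<in> carrier M" "lin b q d \<in> carrier M"
      using c d w bc q g0 by (auto intro!: lin_closed)
    have "lin b (Suc q) d = d q \<odot> b q \<oplus> lin b q d"
      using d bc q g0 by (intro lin_Suc) auto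
    then have eq': "b q = d q \<odot> b q \<oplus> (lin w n c \<oplus> lin b q d)"
      using eq L bq d g0 M.a_lcomm[of "lin w n c" "d q \<odot> b q" "lin b q d"] smult_in[of "d q" "b q"] by simp
    have dq: "vge 0 (d q)" "d q \<odot> b q \<in> carrier M" using d g0 bq smult_in by auto
    have "(1 + - d q) \<odot> b q = b q \<oplus> \<ominus> (d q \<odot> b q)"
      using smult_add_left[of 1 "- d q" "b q"] bq dq smult_minus_left[of "d q" "b q"] smult_one_left[OF bq] by simp
    also have "\<dots> = \<ominus> (d q \<odot> b q) \<oplus> b q" using bq dq M.a_comm by simp
    also have "\<dots> = \<ominus> (d q \<odot> b q) \<oplus> (d q \<odot> b q \<oplus> (lin w n c \<oplus> lin b q d))" using eq' by simp
    also have "\<dots> = lin w n c \<oplus> lin b q d"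
      using dq L by (metis M.a_closed M.r_neg1)
    finally have e1: "(1 + - d q) \<odot> b q = lin w n c \<oplus> lin b q d" .
    have "b q = (u * (1 + - d q)) \<odot> b q" using u1 bq by (simp add: u_def smult_one_left)
    also have "\<dots> = u \<odot> ((1 + - d q) \<odot> b q)" 
      using u bq dq by (intro smult_smult[symmetric] vge_add) auto
    finally have bq_eq: "b q = u \<odot> (lin w n c \<oplus> lin b q d)" unfolding e1 .
    show ?case
    proof
      fix y assume "y \<in> carrier M"
      then obtain c' d' where c': "\<forall>j < n. vge 0 (c' j)" and d': "\<forall>i < Suc q. vgt 0 (d' i)"
        and y: "y = lin w n c' \<oplus> lin b (Suc q) d'" using IH by blast
      have L': "lin w n c' \<in> carrier M" "lin b q d' \<in> carrier M"
        using c' d' w bc q g0 by (auto intro!: lin_closed)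
      have du: "vgt 0 (d' q * u)" using vgt_mult_left[of 0 "d' q" 0 u] u d' by simp
      have d'q: "vge 0 (d' q)" using d' g0 by simp
      have cc: "vge 0 (d' q * u * c j)" if "j < n" for j using c that du g0 vge_0_mult by blast
      have dd: "vgt 0 (d' q * u * d i)" if "i < q" for i
        using vgt_mult_left[OF du, of 0 "d i"] d that g0 by simp
      have "d' q \<odot> b q = d' q \<odot> (u \<odot> (lin w n c \<oplus> lin b q d))" using bq_eq by simp
      also have "\<dots> = (d' q * u) \<odot> (lin w n c \<oplus> lin b q d)"
        using smult_smult[OF d'q u] L by simp
      also have "\<dots> = lin w n (\<lambda>j. d' q * u * c j) \<oplus> lin b q (\<lambda>i. d' q * u * d i)"
        using L du g0 c d w bc q by (simp add: smult_add_right lin_smult)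
      finally have e2: "d' q \<odot> b q = lin w n (\<lambda>j. d' q * u * c j) \<oplus> lin b q (\<lambda>i. d' q * u * d i)" .
      have L'': "lin w n (\<lambda>j. d' q * u * c j) \<in> carrier M" "lin b q (\<lambda>i. d' q * u * d i) \<in> carrier M"
        using cc dd w bc q g0 by (auto intro!: lin_closed)
      have "lin b (Suc q) d' = d' q \<odot> b q \<oplus> lin b q d'"
        using d' bc q g0 by (intro lin_Suc) auto
      then have "y = (lin w n c' \<oplus> lin w n (\<lambda>j. d' q * u * c j)) \<oplus> (lin b q d' \<oplus> lin b q (\<lambda>i. d' q * u * d i))"
        using y e2 L' L'' by (simp add: M.a_ac)
      also have "\<dots> = lin w n (\<lambda>j. c' j + d' q * u * c j) \<oplus> lin b q (\<lambda>i. d' i + d' q * u * d i)"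
        using c' cc w d' dd bc q g0 by (simp add: lin_add)
      finally have "y = \<dots>" .
      moreover have "\<forall>j < n. vge 0 (c' j + d' q * u * c j)" using c' cc vge_add by blast
      moreover have "\<forall>i < q. vgt 0 (d' i + d' q * u * d i)" using d' dd vgt_add by simp
      ultimately show "\<exists>c d. (\<forall>j < n. vge 0 (c j)) \<and> (\<forall>i < q. vgt 0 (d i)) \<and> y = lin w n c \<oplus> lin b q d"
        by (intro exI conjI)
    qed
  qed
  obtain c d where "\<forall>j < n. vge 0 (c j)" "y = lin w n c \<oplus> lin b 0 d" using claim[of 0] y by blast
  then show ?thesis using w lin_closed[of n w c] by auto
qed

end

section \<open>Comparison of lattices with isomorphic reductions\<close>

context valuation
begin

text \<open>
  An isomorphism of the reductions, read on representatives: \<open>w i\<close> represents the image of the class of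
  \<open>b i\<close>.
\<close>

lemma lift_generators:
  fixes M :: "('k, 'm) module" and N :: "('k, 'n) module"
  assumes M: "valuation_module v M" and N: "valuation_module v N" and \<gamma>: "0 \<le> \<gamma>"
    and F: "symmetric_bilinear (valring v) M F" and G: "symmetric_bilinear (valring v) N G"
    and b: "valuation_module.basis v M b n"
    and iso: "form_isomorphic (valring v Quot val_ideal v \<gamma>)
       (quot_module (val_ideal v \<gamma>) M) (quot_form (valring v) (val_ideal v \<gamma>) F)
       (quot_module (val_ideal v \<gamma>) N) (quot_form (valring v) (val_ideal v \<gamma>) G)"
  obtains w where "\<And>i. i < n \<Longrightarrow> w i \<in> carrier N"
    and "\<And>i j. i < n \<Longrightarrow> j < n \<Longrightarrow> vgt \<gamma> (G (w i) (w j) - F (b i) (b j))"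
    and "\<And>y. y \<in> carrier N \<Longrightarrow> \<exists>c. (\<forall>j < n. vge 0 (c j)) \<and>
       (\<exists>e \<in> ideal_smult (val_ideal v \<gamma>) N. y = e \<oplus>\<^bsub>N\<^esub> valuation_module.lin N w n c)"
proof -
  interpret M: valuation_module v M by (rule M)
  interpret N: valuation_module v N by (rule N)
  let ?I = "val_ideal v \<gamma>"
  let ?QM = "quot_module ?I M" and ?QN = "quot_module ?I N"
  let ?m = "\<lambda>x. M.IM \<gamma> +>\<^bsub>M\<^esub> x" and ?n = "\<lambda>x. N.IM \<gamma> +>\<^bsub>N\<^esub> x"
  have bc: "b i \<in> carrier M" if "i < n" for i using b that by (auto simp: M.basis_def)
  from iso obtain \<phi> where \<phi>: "\<phi> \<in> iso (add_monoid ?QM) (add_monoid ?QN)"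
    and lin\<phi>: "\<And>a X. a \<in> carrier (valring v Quot ?I) \<Longrightarrow> X \<in> carrier ?QM \<Longrightarrow> 
       \<phi> (a \<odot>\<^bsub>?QM\<^esub> X) = a \<odot>\<^bsub>?QN\<^esub> \<phi> X"
    and form\<phi>: "\<And>X Y. X \<in> carrier ?QM \<Longrightarrow> Y \<in> carrier ?QM \<Longrightarrow>
       quot_form (valring v) ?I G (\<phi> X) (\<phi> Y) = quot_form (valring v) ?I F X Y"
    unfolding form_isomorphic_def by metis
  have hom: "\<phi> \<in> hom (add_monoid ?QM) (add_monoid ?QN)" and bij: "bij_betw \<phi> (carrier ?QM) (carrier ?QN)"
    using \<phi> by (auto simp: iso_def)
  have add\<phi>: "\<phi> (X \<oplus>\<^bsub>?QM\<^esub> Y) = \<phi> X \<oplus>\<^bsub>?QN\<^esub> \<phi> Y" if "X \<in> carrier ?QM" "Y \<in> carrier ?QM" for X Y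
    using hom_mult[OF hom, of X Y] that by simp
  have mc: "?m x \<in> carrier ?QM" if "x \<in> carrier M" for x
    using that by (auto simp: M.coset_carrier)
  have im: "\<exists>y \<in> carrier N. \<phi> (?m x) = ?n y" if "x \<in> carrier M" for x
    using bij_betwE[OF bij] mc[OF that] by (auto simp: N.coset_carrier)
  have "\<forall>i. \<exists>y. i < n \<longrightarrow> y \<in> carrier N \<and> \<phi> (?m (b i)) = ?n y" using im bc by blast
  then obtain w where w: "\<And>i. i < n \<Longrightarrow> w i \<in> carrier N" "\<And>i. i < n \<Longrightarrow> \<phi> (?m (b i)) = ?n (w i)"
    by metis
  have sm: "\<phi> (?m (a \<odot>\<^bsub>M\<^esub> x)) = ?n (a \<odot>\<^bsub>N\<^esub> y)"
    if "vge 0 a" "x \<in> carrier M" "y \<in> carrier N" "\<phi> (?m x) = ?n y" for a x y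
    using lin\<phi>[OF M.quot_scalar[OF that(1)] mc[OF that(2)]] M.quot_smult[OF \<gamma> that(1,2)]
      N.quot_smult[OF \<gamma> that(1,3)] that(4) by simp
  \<comment> \<open>Linearity of \<open>\<phi>\<close>; the induction on \<open>m \<le> n\<close> allows the use of the two binary operations.\<close>
  have claim: "\<phi> (?m (M.lin b m c)) = ?n (N.lin w m c)" if "m \<le> n" "\<forall>i < n. vge 0 (c i)" for m c
    using that(1)
  proof (induction m)
    case 0
    obtain y where y: "y \<in> carrier N" "\<phi> (?m \<zero>\<^bsub>M\<^esub>) = ?n y" using im[of "\<zero>\<^bsub>M\<^esub>"] by auto
    have "\<phi> (?m (0 \<odot>\<^bsub>M\<^esub> \<zero>\<^bsub>M\<^esub>)) = ?n (0 \<odot>\<^bsub>N\<^esub> y)" by (rule sm[OF _ _ y]) auto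
    then show ?case using y by (simp add: M.smult_zero_left N.smult_zero_left)
  next
    case (Suc m)
    have c: "vge 0 (c i)" if "i < Suc m" for i using that Suc.prems \<open>\<forall>i < n. vge 0 (c i)\<close> by simp
    have bm: "b i \<in> carrier M" "w i \<in> carrier N" if "i < Suc m" for i using that Suc.prems bc w by simp_all
    have L: "M.lin b m c \<in> carrier M" "N.lin w m c \<in> carrier N"
      using bm c by (auto intro!: M.lin_closed N.lin_closed)
    have S: "c m \<odot>\<^bsub>M\<^esub> b m \<in> carrier M" "c m \<odot>\<^bsub>N\<^esub> w m \<in> carrier N"
      using bm c by (auto intro!: M.smult_in N.smult_in)
    have "M.lin b (Suc m) c = c m \<odot>\<^bsub>M\<^esub> b m \<oplus>\<^bsub>M\<^esub> M.lin b m c"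
      using bm c by (intro M.lin_Suc)
    then have "?m (M.lin b (Suc m) c) = ?m (c m \<odot>\<^bsub>M\<^esub> b m) \<oplus>\<^bsub>?QM\<^esub> ?m (M.lin b m c)"
      using M.quot_add[OF \<gamma> S(1) L(1)] by simp
    then have "\<phi> (?m (M.lin b (Suc m) c)) = \<phi> (?m (c m \<odot>\<^bsub>M\<^esub> b m)) \<oplus>\<^bsub>?QN\<^esub> \<phi> (?m (M.lin b m c))"
      using add\<phi>[OF mc[OF S(1)] mc[OF L(1)]] by simp
    also have "\<phi> (?m (c m \<odot>\<^bsub>M\<^esub> b m)) = ?n (c m \<odot>\<^bsub>N\<^esub> w m)"
      using Suc.prems by (intro sm c bm w(2)) auto
    also have "\<phi> (?m (M.lin b m c)) = ?n (N.lin w m c)" using Suc by simp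
    also have "?n (c m \<odot>\<^bsub>N\<^esub> w m) \<oplus>\<^bsub>?QN\<^esub> ?n (N.lin w m c) = ?n (c m \<odot>\<^bsub>N\<^esub> w m \<oplus>\<^bsub>N\<^esub> N.lin w m c)"
      by (rule N.quot_add[OF \<gamma> S(2) L(2)])
    also have "c m \<odot>\<^bsub>N\<^esub> w m \<oplus>\<^bsub>N\<^esub> N.lin w m c = N.lin w (Suc m) c"
      using bm c by (intro N.lin_Suc[symmetric])
    finally show ?case .
  qed
  show ?thesis
  proof (rule that[of w])
    show "w i \<in> carrier N" if "i < n" for i using w that by blast
    show "vgt \<gamma> (G (w i) (w j) - F (b i) (b j))" if ij: "i < n" "j < n" for i j
    proof -
      have "G (w i) (w j) \<in> quot_form (valring v) ?I G (?n (w i)) (?n (w j))"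
        using N.quot_form_iff[OF G \<gamma> w(1)[OF ij(1)] w(1)[OF ij(2)]] by simp
      also have "\<dots> = quot_form (valring v) ?I F (?m (b i)) (?m (b j))"
        using form\<phi>[OF mc[OF bc[OF ij(1)]] mc[OF bc[OF ij(2)]]] w(2) ij by simp
      finally show ?thesis
        using M.quot_form_iff[OF F \<gamma> bc[OF ij(1)] bc[OF ij(2)]] by simp
    qed
    fix y assume y: "y \<in> carrier N"
    then have "?n y \<in> carrier ?QN" by (auto simp: N.coset_carrier)
    then obtain X where X: "X \<in> carrier ?QM" "\<phi> X = ?n y"
      using bij_betw_imp_surj_on[OF bij] by (metis imageE)
    then obtain x where x: "x \<in> carrier M" "X = ?m x" by (auto simp: M.coset_carrier)
    obtain c where c: "\<forall>i < n. vge 0 (c i)" "x = M.lin b n c"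
      using b x(1) unfolding M.basis_def by blast
    have "?n (N.lin w n c) = ?n y" using claim[OF order_refl c(1)] X x c by simp
    then have "y \<in> ?n (N.lin w n c)" using N.coset_self[OF y] by simp
    then obtain e where "e \<in> N.IM \<gamma>" "y = e \<oplus>\<^bsub>N\<^esub> N.lin w n c" using N.coset_memD by blast
    then show "\<exists>c. (\<forall>j < n. vge 0 (c j)) \<and> (\<exists>e \<in> N.IM \<gamma>. y = e \<oplus>\<^bsub>N\<^esub> N.lin w n c)"
      using c(1) by (intro exI[of _ c] conjI bexI[of _ e])
  qed
qed

end

context valuation_module
begin

text \<open>
  If the form is \<open>\<sigma> G\<close> with \<open>G\<close> unimodular, a functional \<open>f\<close> equals \<open>G x\<close> for some \<open>x\<close>.  Applied to a
  coordinate functional this shows that the value \<open>v \<sigma>\<close> is attained.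
\<close>

lemma uni_valued_functionals:
  assumes uni: "uni_valued (valring v) M F" and nz: "carrier M \<noteq> {\<zero>}"
  shows "\<exists>\<sigma>. \<sigma> \<noteq> 0 \<and> vge 0 \<sigma> \<and> lattice_val v M F = v \<sigma> \<and>
     (\<forall>f. functional f \<longrightarrow> (\<exists>x \<in> carrier M. \<forall>y \<in> carrier M. F x y = \<sigma> * f y))"
proof -
  obtain \<sigma> G where \<sigma>: "vge 0 \<sigma>" "\<sigma> \<noteq> 0" and G: "unimodular (valring v) M G"
    and FG: "\<And>x y. x \<in> carrier M \<Longrightarrow> y \<in> carrier M \<Longrightarrow> F x y = \<sigma> * G x y"
    using uni unfolding uni_valued_def by (auto simp: carrier_valring)
  have free: "free_finite_rank (valring v) M" and sb: "symmetric_bilinear (valring v) M G"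
    and bij: "bij_betw (form_to_dual M G) (carrier M) (dual_module (valring v) M)"
    using G unfolding unimodular_def is_lattice_def by auto
  have fn: "\<exists>x \<in> carrier M. \<forall>y \<in> carrier M. F x y = \<sigma> * f y" if f: "functional f" for f
  proof -
    have "restrict f (carrier M) \<in> dual_module (valring v) M"
      using f unfolding dual_module_def hom_def functional_def
      by (auto simp: carrier_valring intro: smult_in)
    then obtain x where x: "x \<in> carrier M" "form_to_dual M G x = restrict f (carrier M)"
      using bij_betw_imp_surj_on[OF bij] by (metis imageE)
    have "F x y = \<sigma> * f y" if "y \<in> carrier M" for y
      using FG[OF x(1) that] fun_cong[OF x(2), of y] that by (simp add: form_to_dual_def)
    then show ?thesis using x by blast
  qed
  obtain b n where b: "basis b n" using basis_exists[OF free] by blast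
  have "n \<noteq> 0"
  proof
    assume "n = 0"
    then have "carrier M \<subseteq> {\<zero>}" using b by (auto simp: basis_def)
    then show False using nz M.zero_closed by blast
  qed
  then have n: "0 < n" by simp
  have b0: "b 0 \<in> carrier M" using b n by (auto simp: basis_def)
  obtain co where co: "\<And>i. i < n \<Longrightarrow> functional (\<lambda>x. co x i)"
    "\<And>c i. (\<And>i. i < n \<Longrightarrow> vge 0 (c i)) \<Longrightarrow> i < n \<Longrightarrow> co (lin b n c) i = c i"
    using coordinate_functionals[OF b] by metis
  have "co (b 0) 0 = 1"
    using co(2)[of "\<lambda>j. if j = 0 then 1 else 0" 0] lin_unit[OF n, of b] b n by (simp add: basis_def)
  with fn[OF co(1)[OF n]] b0 obtain x where x: "x \<in> carrier M" "F x (b 0) = \<sigma>" by auto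
  have "lattice_val v M F = v \<sigma>"
    unfolding lattice_val_def
  proof (rule Least_equality)
    show "\<exists>x \<in> carrier M. \<exists>y \<in> carrier M. F x y \<noteq> 0 \<and> v \<sigma> = v (F x y)"
      using x b0 \<sigma> by metis
    fix \<delta> assume "\<exists>x \<in> carrier M. \<exists>y \<in> carrier M. F x y \<noteq> 0 \<and> \<delta> = v (F x y)"
    then obtain x y where xy: "x \<in> carrier M" "y \<in> carrier M" "F x y \<noteq> 0" "\<delta> = v (F x y)" by blast
    have "vge 0 (G x y)" using form_functional(1)[OF sb xy(2)] xy(1) by (simp add: functional_def)
    then have "0 \<le> v (G x y)" "G x y \<noteq> 0" using FG xy by (auto simp: vge_def)
    then show "v \<sigma> \<le> \<delta>" using FG xy \<sigma> by (simp add: v_mult)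
  qed
  then show ?thesis using \<sigma> fn by blast
qed

text \<open>
  If \<open>x k\<close> represents the restriction of \<open>f\<close> to the component \<open>K k\<close> up to the factor \<open>\<sigma> k\<close>, then the sum of
  the \<open>(s / \<sigma> k) x k\<close> represents \<open>s f\<close>.  The coefficients are integral since the values of the components
  increase up to \<open>v s = v (\<sigma> t)\<close>.
\<close>

lemma jordan_functionals:
  assumes sb: "symmetric_bilinear (valring v) M F" and t: "1 \<le> t" and J: "jordan_decomposition v M F t K"
    and mono: "strict_mono_on {1..t} (\<lambda>k. lattice_val v (M\<lparr>carrier := K k\<rparr>) F)"
  shows "\<exists>s. s \<noteq> 0 \<and> vge 0 s \<and> lattice_val v (M\<lparr>carrier := K t\<rparr>) F = v s \<and>
     (\<forall>f. functional f \<longrightarrow> (\<exists>x \<in> carrier M. \<forall>y \<in> carrier M. F x y = s * f y))"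
proof -
  have sub: "submodule (K k) (valring v) M" and nz: "K k \<noteq> {\<zero>}"
    and uni: "uni_valued (valring v) (M\<lparr>carrier := K k\<rparr>) F" if "k \<in> {1..t}" for k
    using J that unfolding jordan_decomposition_def by blast+
  have dec: "\<exists>!g. g \<in> (\<Pi>\<^sub>E k \<in> {1..t}. K k) \<and> x = (\<Oplus>k \<in> {1..t}. g k)" if "x \<in> carrier M" for x
    using J that unfolding jordan_decomposition_def by simp
  have orth: "F x y = 0" if "i \<in> {1..t}" "j \<in> {1..t}" "i \<noteq> j" "x \<in> K i" "y \<in> K j" for i j x y
    using J that unfolding jordan_decomposition_def by blast
  have Kc: "x \<in> carrier M" if "k \<in> {1..t}" "x \<in> K k" for k x
    using submoduleE(1)[OF sub[OF that(1)]] that(2) by blast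
  have "\<exists>\<sigma>. \<sigma> \<noteq> 0 \<and> vge 0 \<sigma> \<and> lattice_val v (M\<lparr>carrier := K k\<rparr>) F = v \<sigma> \<and>
     (\<forall>f. functional f \<longrightarrow> (\<exists>x \<in> K k. \<forall>y \<in> K k. F x y = \<sigma> * f y))" if k: "k \<in> {1..t}" for k
  proof -
    interpret N: valuation_module v "M\<lparr>carrier := K k\<rparr>"
      by (intro valuation_module.intro valuation_axioms submodule.submodule_is_module[OF sub[OF k]] module_axioms)
    have "N.functional f" if "functional f" for f
      using that Kc[OF k] unfolding functional_def N.functional_def by auto
    then show ?thesis using N.uni_valued_functionals[OF uni[OF k]] nz[OF k] by auto
  qed
  then obtain \<sigma> where \<sigma>: "\<And>k. k \<in> {1..t} \<Longrightarrow> \<sigma> k \<noteq> 0" "\<And>k. k \<in> {1..t} \<Longrightarrow> vge 0 (\<sigma> k)"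
    "\<And>k. k \<in> {1..t} \<Longrightarrow> lattice_val v (M\<lparr>carrier := K k\<rparr>) F = v (\<sigma> k)"
    "\<And>k f. k \<in> {1..t} \<Longrightarrow> functional f \<Longrightarrow> \<exists>x \<in> K k. \<forall>y \<in> K k. F x y = \<sigma> k * f y"
    by metis
  have tt: "t \<in> {1..t}" using t by simp
  define s where "s = \<sigma> t"
  have le: "v (\<sigma> k) \<le> v s" if "k \<in> {1..t}" for k
  proof (cases "k = t")
    case False
    then have "lattice_val v (M\<lparr>carrier := K k\<rparr>) F < lattice_val v (M\<lparr>carrier := K t\<rparr>) F"
      using strict_mono_onD[OF mono that tt] that by simp
    then show ?thesis using \<sigma>(3) that tt by (simp add: s_def)
  qed (simp add: s_def)
  have q: "vge 0 (s / \<sigma> k)" if "k \<in> {1..t}" for k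
    using le[OF that] \<sigma>(1)[OF that] \<sigma>(1)[OF tt] by (simp add: vge_def s_def val_divide)
  have "\<exists>x \<in> carrier M. \<forall>y \<in> carrier M. F x y = s * f y" if f: "functional f" for f
  proof -
    have "\<forall>k. \<exists>x. k \<in> {1..t} \<longrightarrow> x \<in> K k \<and> (\<forall>y \<in> K k. F x y = \<sigma> k * f y)"
      using \<sigma>(4)[OF _ f] by blast
    then obtain x where x: "\<And>k. k \<in> {1..t} \<Longrightarrow> x k \<in> K k"
      "\<And>k y. k \<in> {1..t} \<Longrightarrow> y \<in> K k \<Longrightarrow> F (x k) y = \<sigma> k * f y"
      by metis
    have xc: "x k \<in> carrier M" if "k \<in> {1..t}" for k using x Kc that by blast
    define X where "X = (\<Oplus>k \<in> {1..t}. (s / \<sigma> k) \<odot> x k)"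
    have X: "X \<in> carrier M" unfolding X_def using xc q by (intro M.finsum_closed) (auto intro!: smult_in)
    have "F X y = s * f y" if y: "y \<in> carrier M" for y
    proof -
      obtain g where g: "g \<in> (\<Pi>\<^sub>E k \<in> {1..t}. K k)" "y = (\<Oplus>k \<in> {1..t}. g k)"
        using ex1_implies_ex[OF dec[OF y]] by blast
      have gK: "g k \<in> K k" if "k \<in> {1..t}" for k using g that by auto
      have gc: "g k \<in> carrier M" if "k \<in> {1..t}" for k using gK Kc that by blast
      have e: "F (x k) y = \<sigma> k * f (g k)" if k: "k \<in> {1..t}" for k
      proof -
        have "F (x k) y = (\<Sum>j \<in> {1..t}. F (x k) (g j))"
          unfolding g(2) using form_functional(2)[OF sb xc[OF k]] gc by (intro functional_finsum) auto
        also have "\<dots> = (\<Sum>j \<in> {1..t}. if j = k then F (x k) (g k) else 0)"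
          using orth[OF k _ _ x(1)[OF k]] gK by (intro sum.cong) auto
        also have "\<dots> = F (x k) (g k)" using k by simp
        finally show ?thesis using x(2)[OF k gK[OF k]] by simp
      qed
      have "F X y = (\<Sum>k \<in> {1..t}. F ((s / \<sigma> k) \<odot> x k) y)"
        unfolding X_def using form_functional(1)[OF sb y] xc q
        by (intro functional_finsum[of "\<lambda>x. F x y"]) (auto intro!: smult_in)
      also have "\<dots> = (\<Sum>k \<in> {1..t}. s * f (g k))"
      proof (intro sum.cong refl)
        fix k assume k: "k \<in> {1..t}"
        have "F ((s / \<sigma> k) \<odot> x k) y = s / \<sigma> k * F (x k) y"
          using form_functional(1)[OF sb y] q[OF k] xc[OF k] by (simp add: functional_def)
        then show "F ((s / \<sigma> k) \<odot> x k) y = s * f (g k)" using e[OF k] \<sigma>(1)[OF k] by simp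
      qed
      also have "\<dots> = s * f y"
        unfolding g(2) using functional_finsum[OF f, of "{1..t}" g] gc by (simp add: sum_distrib_left)
      finally show ?thesis .
    qed
    then show ?thesis using X by blast
  qed
  then show ?thesis using \<sigma>(1-3)[OF tt] by (auto simp: s_def)
qed

end

context two_henselian
begin

text \<open>
  For Gram matrices, the hypothesis on functionals yields the matrix \<open>C\<close> of \<open>close_forms\<close>: its rows are the
  coordinates of the elements that represent \<open>s\<close> times the coordinate functionals.
\<close>

lemma isometry_of_close_lattices:
  fixes M :: "('k, 'm) module" and N :: "('k, 'n) module"
  assumes M: "valuation_module v M" and N: "valuation_module v N" 
    and LM: "is_lattice (valring v) M F" and LN: "is_lattice (valring v) N G"
    and s: "s \<noteq> 0" "vge 0 s" and \<gamma>: "\<gamma> = v s + (v 2 + v 2)"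
    and fn: "\<And>f. valuation_module.functional v M f \<Longrightarrow> \<exists>x \<in> carrier M. \<forall>y \<in> carrier M. F x y = s * f y"
    and iso: "form_isomorphic (valring v Quot val_ideal v \<gamma>)
       (quot_module (val_ideal v \<gamma>) M) (quot_form (valring v) (val_ideal v \<gamma>) F)
       (quot_module (val_ideal v \<gamma>) N) (quot_form (valring v) (val_ideal v \<gamma>) G)"
  shows "form_isomorphic (valring v) M F N G"
proof -
  interpret M: valuation_module v M by (rule M)
  interpret N: valuation_module v N by (rule N)
  have F: "symmetric_bilinear (valring v) M F" and G: "symmetric_bilinear (valring v) N G"
    and freeM: "free_finite_rank (valring v) M" and freeN: "free_finite_rank (valring v) N"
    and inj: "inj_on (form_to_dual M F) (carrier M)"
    using LM LN unfolding is_lattice_def by auto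
  have "0 \<le> v s" using s by (simp add: vge_def)
  then have \<gamma>0: "0 \<le> \<gamma>" using val_two_nonneg \<gamma> by simp
  obtain b n where b: "M.basis b n" using M.basis_exists[OF freeM] by blast
  obtain b' r where b': "N.basis b' r" using N.basis_exists[OF freeN] by blast
  have bc: "b i \<in> carrier M" if "i < n" for i using b that by (auto simp: M.basis_def)
  obtain w where w: "\<And>i. i < n \<Longrightarrow> w i \<in> carrier N"
    and gram: "\<And>i j. i < n \<Longrightarrow> j < n \<Longrightarrow> vgt \<gamma> (G (w i) (w j) - F (b i) (b j))"
    and wgen: "\<And>y. y \<in> carrier N \<Longrightarrow> \<exists>c. (\<forall>j < n. vge 0 (c j)) \<and> (\<exists>e \<in> N.IM \<gamma>. y = e \<oplus>\<^bsub>N\<^esub> N.lin w n c)"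
    using lift_generators[OF M N \<gamma>0 F G b iso] by blast
  obtain co where co: "\<And>x i. x \<in> carrier M \<Longrightarrow> i < n \<Longrightarrow> vge 0 (co x i)"
    "\<And>x. x \<in> carrier M \<Longrightarrow> M.lin b n (co x) = x"
    "\<And>i. i < n \<Longrightarrow> M.functional (\<lambda>x. co x i)"
    "\<And>c i. (\<And>i. i < n \<Longrightarrow> vge 0 (c i)) \<Longrightarrow> i < n \<Longrightarrow> co (M.lin b n c) i = c i"
    using M.coordinate_functionals[OF b] by blast
  have co_b: "co (b i) j = (if j = i then 1 else 0)" if "i < n" "j < n" for i j
    using co(4)[of "\<lambda>j. if j = i then 1 else 0" j] M.lin_unit[OF that(1), of b] bc that by simp
  define A where "A = mat n n (\<lambda>(i, j). F (b i) (b j))"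
  define B where "B = mat n n (\<lambda>(i, j). G (w i) (w j))"
  have AB: "A \<in> carrier_mat n n" "B \<in> carrier_mat n n" by (auto simp: A_def B_def)
  have "\<forall>i. \<exists>x. i < n \<longrightarrow> x \<in> carrier M \<and> (\<forall>y \<in> carrier M. F x y = s * co y i)"
    using fn co(3) by blast
  then obtain x where x: "\<And>i. i < n \<Longrightarrow> x i \<in> carrier M" "\<And>i y. i < n \<Longrightarrow> y \<in> carrier M \<Longrightarrow> F (x i) y = s * co y i"
    by metis
  define C where "C = mat n n (\<lambda>(i, j). co (x i) j)"
  have "C * A = s \<cdot>\<^sub>m 1\<^sub>m n"
  proof (rule eq_matI)
    fix i j assume "i < dim_row (s \<cdot>\<^sub>m 1\<^sub>m n)" "j < dim_col (s \<cdot>\<^sub>m 1\<^sub>m n)"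
    then have ij: "i < n" "j < n" by auto
    have "(C * A) $$ (i, j) = (\<Sum>k<n. co (x i) k * F (b k) (b j))"
      using ij by (simp add: C_def A_def scalar_prod_def atLeast0LessThan)
    also have "\<dots> = F (M.lin b n (co (x i))) (b j)"
      using M.form_functional(1)[OF F bc[OF ij(2)]] bc co x ij 
      by (subst M.functional_lin[of "\<lambda>x. F x (b j)"]) auto
    also have "\<dots> = s * co (b j) i" using co(2) x ij bc by simp
    finally show "(C * A) $$ (i, j) = (s \<cdot>\<^sub>m 1\<^sub>m n) $$ (i, j)" using ij co_b by simp
  qed (auto simp: C_def A_def)
  moreover have "mge 0 C" using co x by (auto simp: mge_def C_def)
  moreover have "C \<in> carrier_mat n n" by (simp add: C_def)
  moreover have "A\<^sup>T = A" "B\<^sup>T = B"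
    using M.form_sym[OF F] N.form_sym[OF G] bc w by (auto simp: A_def B_def intro!: eq_matI)
  moreover have "mgt \<gamma> (B - A)" using gram by (auto simp: mgt_def A_def B_def)
  ultimately have "close_forms n s (v s + (v 2 + v 2)) A B"
    using AB \<gamma> by (auto simp: close_forms_def)
  from close_forms_congruent[OF s(1) this] obtain X Y where XY: "integral_inverses n X Y" and A: "A = X\<^sup>T * B * X"
    by (auto simp: congruent_def)
  have Xc: "X \<in> carrier_mat n n" "Y \<in> carrier_mat n n" "X * Y = 1\<^sub>m n" 
    and Xi: "\<And>i j. i < n \<Longrightarrow> j < n \<Longrightarrow> vge 0 (X $$ (i, j))" and Yi: "\<And>i j. i < n \<Longrightarrow> j < n \<Longrightarrow> vge 0 (Y $$ (i, j))"
    using XY by (auto simp: integral_inverses_def mge_def)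
  \<comment> \<open>The corrected lifts have the Gram matrix \<open>X\<^sup>T B X = A\<close>.\<close>
  define w' where "w' j = N.lin w n (\<lambda>i. X $$ (i, j))" for j
  have w': "w' j \<in> carrier N" if "j < n" for j
    unfolding w'_def using w Xi that by (intro N.lin_closed) auto
  have lin_w': "N.lin w' n c = N.lin w n (\<lambda>i. \<Sum>j<n. X $$ (i, j) * c j)" if "\<And>j. j < n \<Longrightarrow> vge 0 (c j)" for c
    unfolding w'_def using w Xi that by (intro N.lin_lin) auto
  have Gw': "G (w' i) (w' j) = F (b i) (b j)" if ij: "i < n" "j < n" for i j
  proof -
    have "G (w' i) (w' j) = (\<Sum>k<n. X $$ (k, i) * G (w k) (w' j))"
      unfolding w'_def[of i] using N.form_functional(1)[OF G w'[OF ij(2)]] w Xi ij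
      by (subst N.functional_lin[of "\<lambda>x. G x (w' j)"]) auto
    also have "\<dots> = (\<Sum>k<n. X $$ (k, i) * (\<Sum>l<n. X $$ (l, j) * G (w k) (w l)))"
    proof (intro sum.cong refl arg_cong[of _ _ "\<lambda>x. _ * x"])
      fix k assume "k \<in> {..<n}"
      then show "G (w k) (w' j) = (\<Sum>l<n. X $$ (l, j) * G (w k) (w l))"
        unfolding w'_def[of j] using N.form_functional(2)[OF G w[of k]] w Xi ij
        by (subst N.functional_lin[of "G (w k)"]) auto
    qed
    also have "\<dots> = (X\<^sup>T * (B * X)) $$ (i, j)"
      using Xc AB ij by (simp add: scalar_prod_def B_def atLeast0LessThan mult.commute)
    also have "\<dots> = A $$ (i, j)" unfolding A using Xc AB by (simp add: assoc_mult_mat[of _ n n _ n _ n])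
    finally show ?thesis using ij by (simp add: A_def)
  qed
  define \<Phi> where "\<Phi> x = N.lin w' n (co x)" for x
  have \<Phi>c: "\<Phi> x \<in> carrier N" if "x \<in> carrier M" for x
    unfolding \<Phi>_def using w' co that by (intro N.lin_closed) auto
  have \<Phi>_add: "\<Phi> (x \<oplus>\<^bsub>M\<^esub> y) = \<Phi> x \<oplus>\<^bsub>N\<^esub> \<Phi> y" if "x \<in> carrier M" "y \<in> carrier M" for x y
  proof -
    have "\<Phi> (x \<oplus>\<^bsub>M\<^esub> y) = N.lin w' n (\<lambda>i. co x i + co y i)"
      unfolding \<Phi>_def using w' co that by (intro N.lin_cong) (auto simp: M.functional_def intro!: vge_add)
    also have "\<dots> = \<Phi> x \<oplus>\<^bsub>N\<^esub> \<Phi> y"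
      unfolding \<Phi>_def using w' co that by (intro N.lin_add) auto
    finally show ?thesis .
  qed
  have \<Phi>_smult: "\<Phi> (a \<odot>\<^bsub>M\<^esub> x) = a \<odot>\<^bsub>N\<^esub> \<Phi> x" if "vge 0 a" "x \<in> carrier M" for a x
  proof -
    have "\<Phi> (a \<odot>\<^bsub>M\<^esub> x) = N.lin w' n (\<lambda>i. a * co x i)"
      unfolding \<Phi>_def using w' co that M.smult_in by (intro N.lin_cong) (auto simp: M.functional_def intro!: vge_0_mult)
    also have "\<dots> = a \<odot>\<^bsub>N\<^esub> \<Phi> x"
      unfolding \<Phi>_def using w' co that by (intro N.lin_smult) auto
    finally show ?thesis .
  qed
  have \<Phi>_form: "G (\<Phi> x) (\<Phi> y) = F x y" if xy: "x \<in> carrier M" "y \<in> carrier M" for x y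
  proof -
    have "G (\<Phi> x) (\<Phi> y) = (\<Sum>i<n. co x i * G (w' i) (\<Phi> y))"
      unfolding \<Phi>_def[of x] using N.form_functional(1)[OF G \<Phi>c[OF xy(2)]] w' co xy
      by (subst N.functional_lin[of "\<lambda>x. G x (\<Phi> y)"]) auto
    also have "\<dots> = (\<Sum>i<n. co x i * F (b i) y)"
    proof (intro sum.cong refl arg_cong[of _ _ "\<lambda>x. _ * x"])
      fix i assume "i \<in> {..<n}"
      then have i: "i < n" by simp
      have "G (w' i) (\<Phi> y) = (\<Sum>j<n. co y j * G (w' i) (w' j))"
        unfolding \<Phi>_def using N.form_functional(2)[OF G w'[OF i]] w' co xy
        by (subst N.functional_lin[of "G (w' i)"]) auto
      also have "\<dots> = (\<Sum>j<n. co y j * F (b i) (b j))" using Gw' i by simp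
      also have "\<dots> = F (b i) (M.lin b n (co y))"
        using M.form_functional(2)[OF F bc[OF i]] bc co xy
        by (subst M.functional_lin[of "F (b i)"]) auto
      finally show "G (w' i) (\<Phi> y) = F (b i) y" using co(2) xy by simp
    qed
    also have "\<dots> = F (M.lin b n (co x)) y"
      using M.form_functional(1)[OF F xy(2)] bc co xy
      by (subst M.functional_lin[of "\<lambda>x. F x y"]) auto
    finally show ?thesis using co(2) xy by simp
  qed
  have "inj_on \<Phi> (carrier M)"
  proof (rule inj_onI)
    fix x y assume xy: "x \<in> carrier M" "y \<in> carrier M" "\<Phi> x = \<Phi> y"
    have "F x z = F y z" if "z \<in> carrier M" for z
      using \<Phi>_form[OF xy(1) that] \<Phi>_form[OF xy(2) that] xy(3) by simp
    then have "form_to_dual M F x = form_to_dual M F y"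
      unfolding form_to_dual_def by (intro restrict_ext) auto
    then show "x = y" using inj xy by (auto dest: inj_onD)
  qed
  moreover have "\<Phi> ` carrier M = carrier N"
  proof (intro equalityI subsetI)
    fix y assume y: "y \<in> carrier N"
    obtain c where c: "\<forall>j < n. vge 0 (c j)" "y = N.lin w n c"
      using N.nakayama[OF b' \<gamma>0 w wgen y] by blast
    define d where "d j = (\<Sum>k<n. Y $$ (j, k) * c k)" for j
    have d: "vge 0 (d j)" if "j < n" for j
      unfolding d_def using Yi c(1) that by (auto intro!: vge_sum vge_0_mult)
    have "(\<Sum>j<n. X $$ (i, j) * d j) = c i" if i: "i < n" for i
    proof -
      have "(\<Sum>j<n. X $$ (i, j) * d j) = (\<Sum>k<n. (\<Sum>j<n. X $$ (i, j) * Y $$ (j, k)) * c k)"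
        unfolding d_def sum_distrib_left sum_distrib_right by (subst sum.swap) (simp add: mult.assoc)
      also have "\<dots> = (\<Sum>k<n. (X * Y) $$ (i, k) * c k)"
        using Xc(1,2) i by (intro sum.cong refl arg_cong2[of _ _ _ _ "(*)"]) (auto simp: scalar_prod_def atLeast0LessThan)
      also have "\<dots> = (\<Sum>k<n. if k = i then c i else 0)"
        unfolding Xc(3) using i by (intro sum.cong) auto
      finally show ?thesis using i by simp
    qed
    then have "N.lin w n c = N.lin w n (\<lambda>i. \<Sum>j<n. X $$ (i, j) * d j)"
      using w c by (intro N.lin_cong) auto
    also have "\<dots> = N.lin w' n d" using lin_w' d by simp
    also have "\<dots> = \<Phi> (M.lin b n d)"
      unfolding \<Phi>_def using w' d co(4)[of d] by (intro N.lin_cong) auto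
    finally have "y = \<Phi> (M.lin b n d)" using c by simp
    then show "y \<in> \<Phi> ` carrier M" using M.lin_closed[of n b d] bc d by blast
  qed (use \<Phi>c in auto)
  ultimately have "\<Phi> \<in> iso (add_monoid M) (add_monoid N)"
    using \<Phi>c \<Phi>_add by (auto simp: iso_def hom_def bij_betw_def)
  then show ?thesis unfolding form_isomorphic_def
    using \<Phi>_smult \<Phi>_form by (intro bexI[of _ \<Phi>]) (auto simp: carrier_valring)
qed

end

theorem theorem1p5:
  fixes v :: "'k::field \<Rightarrow> 'g::linordered_ab_group_add"
    and M :: "('k, 'm) module" and F :: "'m \<Rightarrow> 'm \<Rightarrow> 'k"
    and N :: "('k, 'n) module" and G :: "'n \<Rightarrow> 'n \<Rightarrow> 'k"
    and t :: nat and K :: "nat \<Rightarrow> 'm set" and R :: "'k ring" and I :: "'k set"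
  assumes "two_henselian v"
    and R: "R = valring v"
    and "is_lattice R M F"
    and "is_lattice R N G"
    and "1 \<le> t"
    and "jordan_decomposition v M F t K"
    and "strict_mono_on {1..t} (\<lambda>k. lattice_val v (M\<lparr>carrier := K k\<rparr>) F)"
    and I: "I = val_ideal v (lattice_val v (M\<lparr>carrier := K t\<rparr>) F + (v 2 + v 2))"
    and "form_isomorphic (R Quot I) (quot_module I M) (quot_form R I F)
           (quot_module I N) (quot_form R I G)"
  shows "form_isomorphic R M F N G"
proof -
  interpret two_henselian v by fact
  have mod: "valuation_module v M" "valuation_module v N"
    using assms(3,4) valuation_axioms unfolding R is_lattice_def valuation_module_def by auto
  interpret M: valuation_module v M by (rule mod(1))
  have "symmetric_bilinear (valring v) M F" using assms(3) unfolding R is_lattice_def by simp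
  from M.jordan_functionals[OF this assms(5-7)] obtain s where s: "s \<noteq> 0" "vge 0 s"
    and val: "lattice_val v (M\<lparr>carrier := K t\<rparr>) F = v s"
    and fn: "\<And>f. M.functional f \<Longrightarrow> \<exists>x \<in> carrier M. \<forall>y \<in> carrier M. F x y = s * f y"
    by blast
  show ?thesis unfolding R
    by (rule isometry_of_close_lattices[OF mod assms(3,4)[unfolded R] s refl fn assms(9)[unfolded R I val]])
qed

end
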